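(* Let $k\ge1$, let $z_1,\dots,z_{2k}\in\mathbb{C}$ be distinct, $D(z)=\prod_{i=1}^{2k}(z-z_i)$, and let $U_D$ be the admissible entire function corresponding to the harmonic function $\ln|z|$ on $\mathbb{C}\setminus\{0\}$. (1) If $(p(z),q(z))$ is a pair of polynomials that satisfies the polynomial Pell equation $$p(z)^2-D(z)q(z)^2=1,$$ then $\dfrac{p'(z)}{q(z)}$ is equal to $U_D(z)$ up to multiplication by a real-valued constant. (2) Moreover, a pair $(p(z),q(z))$ satisfies the polynomial Pell equation if and only if the following algebraic expression of the Abel integration holds: $$\int\frac{U_D(z)}{\sqrt{D(z)}}\,dz=C\ln\bigl(p(z)+q(z)\sqrt{D(z)}\bigr),\quad\text{where } C \text{ is a real-valued constant.}$$
   Context: Polynomials have complex coefficients. Let $K=\{z_1,\dots,z_{2k}\}$, $X=\mathbb{C}\setminus K$, and let $\mathcal{L}$ be the unique real line bundle on $X$ with monodromy $-1$ around each point of $K$. A $\mathbb{Z}_2$ harmonic function is a section $f$ of $\mathcal{L}$ with $\Delta f=0$ in every local trivialization (where it is an ordinary real function up to sign), and such that $|\nabla f|$ has finite $L^2$ norm on every bounded open subset of $X$ (including punctured neighborhoods of the points of $K$). A trivialization of $\mathcal{L}$ outside a large disk containing $K$ is fixed, via which sections are ordinary functions near infinity. An entire function $u$ is admissible if $\mathrm{Re}\bigl(\int_{z_1}^{z_j}\frac{u(z)}{\sqrt{D(z)}}dz\bigr)=0$ for all $j=2,\dots,2k$ (this condition is independent of the choice of paths and of the sign of $\sqrt D$).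 A sign convention for $\sqrt{D}$ as a section of $\mathcal{L}\otimes\mathbb{C}$ is fixed in defining $U_D$. There is a unique $\mathbb{Z}_2$ harmonic function $G_D$ on $X$ such that $G_D(z)-\ln|z|$ tends to a constant as $|z|\to+\infty$, and $U_D$ is the unique admissible entire function with $G_D(z)=\mathrm{Re}\bigl(\int_{z_1}^z\frac{U_D(\zeta)}{\sqrt{D(\zeta)}}d\zeta\bigr)$.
   Formalization: In (2) the Pell side also requires q ≠ 0 (for (±1,0) the formula fails), and the integral is taken from z_1 with constant of integration only C·nπi, n an integer (an arbitrary constant would allow rescaled pairs); in (1) nothing is claimed for q = 0. *)

theory Defs
  imports "HOL-Complex_Analysis.Complex_Analysis"
begin

text \<open>
  The points are \<open>z 1, \<dots>, z (2 * k)\<close>; values of \<open>z\<close> at other indices play no role.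
\<close>

definition points :: "nat \<Rightarrow> (nat \<Rightarrow> complex) \<Rightarrow> complex set" where
  "points k z = z ` {1..2 * k}"

definition D_poly :: "nat \<Rightarrow> (nat \<Rightarrow> complex) \<Rightarrow> complex poly" where
  "D_poly k z = (\<Prod>i = 1..2 * k. [:- z i, 1:])"

text \<open>
  The double cover \<open>{(x, w). x \<in> X \<and> w\<^sup>2 = D x}\<close> of \<open>X = \<complex> - K\<close> has monodromy \<open>w \<mapsto> - w\<close> around
  each point of \<open>K\<close>, so the line bundle \<open>L\<close> is the quotient of (double cover) \<open>\<times> \<real>\<close> by
  \<open>(x, w, r) \<mapsto> (x, - w, - r)\<close>.  Accordingly:
    \<^item> a local trivialization of \<open>L\<close> over an open set \<open>V\<close> is a continuous branch \<open>s\<close> of \<open>sqrt D\<close> on \<open>V\<close>;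
    \<^item> a section of \<open>L\<close> is a function \<open>f x w\<close> on the double cover that is odd in \<open>w\<close>; in the
      trivialization \<open>s\<close> it is the ordinary function \<open>\<lambda>x. f x (s x)\<close>;
    \<^item> \<open>sqrt D\<close> itself, as a section of \<open>L \<otimes> \<complex>\<close>, is \<open>(x, w) \<mapsto> w\<close>.
  Values of \<open>f\<close> off the double cover play no role.
\<close>

definition local_triv ::
  "nat \<Rightarrow> (nat \<Rightarrow> complex) \<Rightarrow> complex set \<Rightarrow> (complex \<Rightarrow> complex) \<Rightarrow> bool" where
  "local_triv k z V s \<longleftrightarrow>
     open V \<and> V \<inter> points k z = {} \<and> continuous_on V s \<and>
     (\<forall>x\<in>V. (s x)\<^sup>2 = poly (D_poly k z) x)"

definition is_section ::
  "nat \<Rightarrow> (nat \<Rightarrow> complex) \<Rightarrow> (complex \<Rightarrow> complex \<Rightarrow> real) \<Rightarrow> bool" where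
  "is_section k z f \<longleftrightarrow>
     (\<forall>x w. x \<notin> points k z \<longrightarrow> w\<^sup>2 = poly (D_poly k z) x \<longrightarrow> f x (- w) = - f x w)"

definition harmonic_on :: "(complex \<Rightarrow> real) \<Rightarrow> complex set \<Rightarrow> bool" where
  "harmonic_on u V \<longleftrightarrow>
     (\<exists>ux uy uxx uxy uyx uyy.
        continuous_on V uxx \<and> continuous_on V uxy \<and>
        continuous_on V uyx \<and> continuous_on V uyy \<and>
        (\<forall>x\<in>V.
           (u has_derivative (\<lambda>h. ux x * Re h + uy x * Im h)) (at x) \<and>
           (ux has_derivative (\<lambda>h. uxx x * Re h + uxy x * Im h)) (at x) \<and>
           (uy has_derivative (\<lambda>h. uyx x * Re h + uyy x * Im h)) (at x) \<and>
           uxx x + uyy x = 0))"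

definition grad :: "(complex \<Rightarrow> real) \<Rightarrow> complex \<Rightarrow> complex" where
  "grad u x = Complex (frechet_derivative u (at x) 1) (frechet_derivative u (at x) \<i>)"

text \<open>
  In the last clause \<open>g\<close> is \<open>|\<nabla>f|\<close>; it is determined on \<open>X\<close>, because \<open>X\<close> is covered by the domains
  of local trivializations and the sign of the trivialization does not affect the norm.
\<close>

definition Z2_harmonic ::
  "nat \<Rightarrow> (nat \<Rightarrow> complex) \<Rightarrow> (complex \<Rightarrow> complex \<Rightarrow> real) \<Rightarrow> bool" where
  "Z2_harmonic k z f \<longleftrightarrow>
     is_section k z f \<and>
     (\<forall>V s. local_triv k z V s \<longrightarrow> harmonic_on (\<lambda>x. f x (s x)) V) \<and>
     (\<exists>g :: complex \<Rightarrow> real.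
        (\<forall>V s x. local_triv k z V s \<and> x \<in> V \<longrightarrow> g x = norm (grad (\<lambda>y. f y (s y)) x)) \<and>
        (\<forall>V. open V \<and> bounded V \<and> V \<inter> points k z = {} \<longrightarrow>
             set_integrable lborel V (\<lambda>x. (g x)\<^sup>2)))"

text \<open>
  \<open>abel_integral k z u x w A\<close>: \<open>A\<close> is the integral of \<open>u / sqrt D\<close> along some path from \<open>z 1\<close> to \<open>x\<close>
  that avoids \<open>K\<close> except possibly at its endpoints, where \<open>sqrt D\<close> is continued along the path (this
  is \<open>s\<close>) and ends with the value \<open>w\<close>.  The integrand may be unbounded at the endpoints; the
  gauge integral covers such improper integrals.
\<close>

definition abel_integral ::
  "nat \<Rightarrow> (nat \<Rightarrow> complex) \<Rightarrow> (complex \<Rightarrow> complex) \<Rightarrow> complex \<Rightarrow> complex \<Rightarrow> complex \<Rightarrow> bool" where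
  "abel_integral k z u x w A \<longleftrightarrow>
     (\<exists>\<gamma> s. valid_path \<gamma> \<and> pathstart \<gamma> = z 1 \<and> pathfinish \<gamma> = x \<and>
        (\<forall>t\<in>{0<..<1}. \<gamma> t \<notin> points k z) \<and>
        continuous_on {0..1} s \<and> (\<forall>t\<in>{0..1}. (s t)\<^sup>2 = poly (D_poly k z) (\<gamma> t)) \<and> s 1 = w \<and>
        ((\<lambda>t. u (\<gamma> t) / s t * vector_derivative \<gamma> (at t within {0..1})) has_integral A) {0..1})"

definition admissible :: "nat \<Rightarrow> (nat \<Rightarrow> complex) \<Rightarrow> (complex \<Rightarrow> complex) \<Rightarrow> bool" where
  "admissible k z u \<longleftrightarrow>
     u holomorphic_on UNIV \<and>
     (\<forall>j\<in>{2..2 * k}. \<forall>w A. abel_integral k z u (z j) w A \<longrightarrow> Re A = 0)"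

text \<open>
  \<open>s\<close> is a trivialization of \<open>L\<close> outside a large disk.  Replacing \<open>s\<close> by \<open>- s\<close> replaces \<open>G\<close> by \<open>- G\<close>.
\<close>

definition is_G_D ::
  "nat \<Rightarrow> (nat \<Rightarrow> complex) \<Rightarrow> (complex \<Rightarrow> complex) \<Rightarrow> (complex \<Rightarrow> complex \<Rightarrow> real) \<Rightarrow> bool" where
  "is_G_D k z s G \<longleftrightarrow>
     Z2_harmonic k z G \<and> (\<exists>c. ((\<lambda>x. G x (s x) - ln (cmod x)) \<longlongrightarrow> c) at_infinity)"

definition is_U_D ::
  "nat \<Rightarrow> (nat \<Rightarrow> complex) \<Rightarrow> (complex \<Rightarrow> complex \<Rightarrow> real) \<Rightarrow> (complex \<Rightarrow> complex) \<Rightarrow> bool" where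
  "is_U_D k z G U \<longleftrightarrow>
     admissible k z U \<and>
     (\<forall>x w A. x \<notin> points k z \<longrightarrow> abel_integral k z U x w A \<longrightarrow> G x w = Re A)"

definition pell :: "nat \<Rightarrow> (nat \<Rightarrow> complex) \<Rightarrow> complex poly \<Rightarrow> complex poly \<Rightarrow> bool" where
  "pell k z p q \<longleftrightarrow> p\<^sup>2 - D_poly k z * q\<^sup>2 = 1"

text \<open>
  The identity \<open>\<integral> u / sqrt D = C ln (p + q sqrt D)\<close> between multivalued functions: every value of the
  integral from \<open>z 1\<close> is a value of \<open>C ln (p + q sqrt D) + C n \<pi> \<i>\<close>, with a fixed integer \<open>n\<close>.
  The constant of integration is restricted to this form for two reasons.  An arbitrary constant
  would make the identity invariant under \<open>(p, q) \<mapsto> (a p, a q)\<close>, which the Pell equation is not.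
  On the other hand a solution of the Pell equation may have \<open>p (z 1) = - 1\<close>, where
  \<open>ln (p + q sqrt D)\<close> takes the values \<open>(2 m + 1) \<pi> \<i>\<close> while the integral vanishes.
\<close>

definition abel_log_formula ::
  "nat \<Rightarrow> (nat \<Rightarrow> complex) \<Rightarrow> (complex \<Rightarrow> complex) \<Rightarrow> complex poly \<Rightarrow> complex poly \<Rightarrow> real \<Rightarrow> bool" where
  "abel_log_formula k z u p q C \<longleftrightarrow>
     (\<exists>n :: int. \<forall>x w A. x \<notin> points k z \<longrightarrow> abel_integral k z u x w A \<longrightarrow>
        (\<exists>l. exp l = poly p x + poly q x * w \<and>
             A = of_real C * (l + of_int n * of_real pi * \<i>)))"

end

theory Submission
  imports Defs
begin

text \<open>
  The differential of \<open>ln |p + q sqrt D|\<close> is the real part of \<open>p' / (q sqrt D) dx\<close>, and this function, up to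
  sign, grows like \<open>m ln |x|\<close> with \<open>m = degree p\<close>.  Hence for a suitable sign
  \<open>H = \<plusminus> m G - ln |p + q sqrt D|\<close> is a bounded section whose differential is \<open>Re (W / sqrt D dx)\<close> with
  \<open>W = \<plusminus> m U - p' / q\<close> entire.  In the coordinate \<open>y\<close> with \<open>x = c + y\<^sup>2\<close> near a branch point \<open>c\<close> this differential is
  regular; since \<open>H\<close> is odd in \<open>y\<close>, it tends to \<open>0\<close> at \<open>c\<close>.  Therefore \<open>|H|\<close> is continuous on the plane, and
  comparison with \<open>\<delta> ln |x|\<close> near infinity shows that it attains its maximum, so \<open>W = 0\<close> by the maximum
  principle.  Then \<open>p + q sqrt D\<close> is a constant times the exponential of a real multiple of the Abel integral.
  Conversely, changing the sign of \<open>sqrt D\<close> along a path negates the Abel integral, so the logarithmic formula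
  forces \<open>(p + q sqrt D) (p - q sqrt D) = 1\<close>.
\<close>

section \<open>Strong maximum principle\<close>

text \<open>On a ball \<open>u\<close> differs by a constant from \<open>Re F\<close> for a
  primitive \<open>F\<close> of \<open>\<phi>\<close>. Hence the modulus of \<open>exp F\<close> is
  largest at the centre, and the maximum modulus principle makes \<open>exp F\<close>
  constant.\<close>

lemma harmonic_max_imp_zero:
  fixes \<phi> :: "complex \<Rightarrow> complex" and u :: "complex \<Rightarrow> real"
  assumes "open V" "x0 \<in> V" "\<phi> holomorphic_on V"
    and der: "\<And>x. x \<in> V \<Longrightarrow> (u has_derivative (\<lambda>h. Re (\<phi> x * h))) (at x)"
    and max: "\<And>x. x \<in> V \<Longrightarrow> u x \<le> u x0"
  shows "\<exists>r>0. ball x0 r \<subseteq> V \<and> (\<forall>x\<in>ball x0 r. \<phi> x = 0)"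
proof -
  obtain r where r: "r > 0" "ball x0 r \<subseteq> V"
    using assms(1,2) open_contains_ball by blast
  let ?B = "ball x0 r"
  have hol: "\<phi> holomorphic_on ?B"
    using assms(3) r(2) holomorphic_on_subset by blast
  obtain F where F: "\<And>x. x \<in> ?B \<Longrightarrow> (F has_field_derivative \<phi> x) (at x)"
    using holomorphic_convex_primitive'[OF _ _ hol] by (metis at_within_open convex_ball open_ball)
  have "u x - Re (F x) = u x0 - Re (F x0)" if "x \<in> ?B" for x
  proof (rule has_derivative_zero_unique_connected[of ?B])
    fix x assume x: "x \<in> ?B"
    have "((\<lambda>x. Re (F x)) has_derivative (\<lambda>h. Re (\<phi> x * h))) (at x)"
      using F[OF x] unfolding has_field_derivative_def by (rule has_derivative_Re)
    from has_derivative_diff[OF der this] x r show "((\<lambda>x. u x - Re (F x)) has_derivative (\<lambda>h. 0)) (at x)"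
      by (auto simp: subset_iff)
  qed (use that r in auto)
  then have Fmax: "Re (F x) \<le> Re (F x0)" if "x \<in> ?B" for x
    using max[of x] that r(2) by (smt (verit) subset_iff)
  have "F holomorphic_on ?B"
    using F holomorphic_on_open[OF open_ball] by blast
  then have "(\<lambda>x. exp (F x)) constant_on ?B"
    by (intro maximum_modulus_principle[of _ ?B ?B x0])
      (use r Fmax in \<open>auto intro!: holomorphic_intros\<close>)
  then obtain c where c: "\<And>x. x \<in> ?B \<Longrightarrow> exp (F x) = c"
    unfolding constant_on_def by blast
  have "\<phi> x = 0" if x: "x \<in> ?B" for x
  proof -
    have "((\<lambda>x. exp (F x)) has_field_derivative exp (F x) * \<phi> x) (at x)"
      by (rule DERIV_fun_exp[OF F[OF x]])
    moreover have "((\<lambda>x. exp (F x)) has_field_derivative 0) (at x)"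
      by (rule has_field_derivative_transform_within_open[of "\<lambda>_. c" 0 x ?B]) (use c x in auto)
    ultimately show ?thesis
      using DERIV_unique by fastforce
  qed
  with r show ?thesis by blast
qed

section \<open>Branches of the square root of \<open>D\<close>\<close>

text \<open>The alternative \<open>f y = - g y\<close> is excluded because \<open>f + g\<close>
  stays close to \<open>2 * g a\<close>, which is nonzero.\<close>

lemma square_eq_eventually:
  fixes f g :: "'a :: t2_space \<Rightarrow> complex"
  assumes f: "isCont f a" and g: "isCont g a" and "f a = g a" "g a \<noteq> 0"
    and ev: "\<forall>\<^sub>F y in nhds a. (f y)\<^sup>2 = (g y)\<^sup>2"
  shows "\<forall>\<^sub>F y in nhds a. f y = g y"
proof -
  have "isCont (\<lambda>y. f y + g y) a" by (intro continuous_intros f g)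
  then have "((\<lambda>y. f y + g y) \<longlongrightarrow> f a + g a) (nhds a)"
    using tendsto_at_iff_tendsto_nhds[of "\<lambda>y. f y + g y" a] by (simp add: isCont_def)
  moreover have "f a + g a \<noteq> 0" using assms by simp
  ultimately have "\<forall>\<^sub>F y in nhds a. f y + g y \<noteq> 0" by (rule tendsto_imp_eventually_ne)
  with ev show ?thesis
    by eventually_elim (auto simp: power2_eq_iff)
qed

locale branch_points =
  fixes k :: nat and z :: "nat \<Rightarrow> complex"
  assumes k_pos: "k \<ge> 1" and inj_z: "inj_on z {1..2 * k}"
begin

abbreviation K :: "complex set" where "K \<equiv> points k z"
abbreviation D :: "complex \<Rightarrow> complex" where "D \<equiv> poly (D_poly k z)"

lemma finite_K: "finite K"
  by (simp add: points_def)

lemma D_eq_prod: "D x = (\<Prod>a\<in>K. x - a)"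
  unfolding D_poly_def points_def prod.reindex[OF inj_z] poly_prod by simp

lemma D_eq_0_iff: "D x = 0 \<longleftrightarrow> x \<in> K"
  by (auto simp: D_eq_prod finite_K)

lemma degree_D: "degree (D_poly k z) = 2 * k"
  by (simp add: D_poly_def degree_prod_eq_sum_degree)

lemma z1_in_K: "z 1 \<in> K"
  using k_pos by (auto simp: points_def)

text \<open>Dividing by \<open>D x0\<close> moves the base value to 1, where the principal root is
  continuous with value 1; the factor \<open>w0\<close> then selects the branch. Points of
  \<open>K\<close> drop out because the quotient is 0 there.\<close>

lemma exists_branch:
  assumes "x0 \<notin> K" "w0\<^sup>2 = D x0"
  obtains V \<sigma> where "local_triv k z V \<sigma>" "x0 \<in> V" "\<sigma> x0 = w0"
proof -
  let ?V = "{x. D x / D x0 \<in> - \<real>\<^sub>\<le>\<^sub>0}" and ?s = "\<lambda>x. w0 * csqrt (D x / D x0)"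
  have D0: "D x0 \<noteq> 0" using assms by (simp add: D_eq_0_iff)
  have cont: "continuous_on UNIV (\<lambda>x. D x / D x0)"
    by (intro continuous_intros) (use D0 in auto)
  have "open ?V"
    using open_vimage[OF _ cont, of "- \<real>\<^sub>\<le>\<^sub>0"] by (simp add: vimage_def open_Compl)
  moreover have "continuous_on ?V ?s"
    by (intro continuous_intros continuous_on_compose2[OF continuous_on_csqrt]) (use D0 in auto)
  moreover have "(?s x)\<^sup>2 = D x" for x
    using D0 assms(2) by (simp add: power_mult_distrib)
  moreover have "x0 \<in> ?V" "?V \<inter> K = {}" "?s x0 = w0"
    using D0 by (auto simp: D_eq_0_iff[symmetric])
  ultimately show ?thesis
    using that[of ?V ?s] unfolding local_triv_def by blast
qed

lemma local_trivD:
  assumes "local_triv k z V \<sigma>"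
  shows "open V" "x \<in> V \<Longrightarrow> x \<notin> K" "x \<in> V \<Longrightarrow> (\<sigma> x)\<^sup>2 = D x" "x \<in> V \<Longrightarrow> \<sigma> x \<noteq> 0"
    "x \<in> V \<Longrightarrow> isCont \<sigma> x" "continuous_on V \<sigma>"
  using assms D_eq_0_iff[of x] unfolding local_triv_def
  by (auto simp: continuous_on_eq_continuous_at)

lemma local_triv_minus: "local_triv k z V \<sigma> \<Longrightarrow> local_triv k z V (\<lambda>x. - \<sigma> x)"
  unfolding local_triv_def by (auto intro: continuous_on_minus)

text \<open>Continuity alone yields the derivative: \<open>D y - D x\<close> factors as
  \<open>(\<sigma> y - \<sigma> x) * (\<sigma> y + \<sigma> x)\<close>, and the second factor tends
  to \<open>2 * \<sigma> x\<close>, which is nonzero.\<close>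

lemma branch_has_field_derivative:
  assumes t: "local_triv k z V \<sigma>" and x: "x \<in> V"
  shows "(\<sigma> has_field_derivative poly (pderiv (D_poly k z)) x / (2 * \<sigma> x)) (at x)"
proof -
  note T = local_trivD[OF t]
  have "((\<lambda>y. (D y - D x) / (y - x) / (\<sigma> y + \<sigma> x)) \<longlongrightarrow> poly (pderiv (D_poly k z)) x / (\<sigma> x + \<sigma> x)) (at x)"
    using poly_DERIV[of "D_poly k z" x] T(4,5)[OF x]
    by (intro tendsto_intros) (auto simp: has_field_derivative_iff isCont_def)
  moreover have "\<forall>\<^sub>F y in at x. (D y - D x) / (y - x) / (\<sigma> y + \<sigma> x) = (\<sigma> y - \<sigma> x) / (y - x)"
  proof -
    have "((\<lambda>y. \<sigma> y + \<sigma> x) \<longlongrightarrow> \<sigma> x + \<sigma> x) (at x)"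
      using T(5)[OF x] by (intro tendsto_intros) (auto simp: isCont_def)
    moreover have "\<sigma> x + \<sigma> x \<noteq> 0" using T(4)[OF x] by simp
    ultimately have "\<forall>\<^sub>F y in at x. \<sigma> y + \<sigma> x \<noteq> 0" by (rule tendsto_imp_eventually_ne)
    moreover have "\<forall>\<^sub>F y in at x. y \<in> V" using T(1) x by (rule eventually_at_in_open')
    ultimately show ?thesis
    proof eventually_elim
      case (elim y)
      have "D y - D x = (\<sigma> y - \<sigma> x) * (\<sigma> y + \<sigma> x)"
        using T(3)[OF elim(2)] T(3)[OF x] by (simp add: algebra_simps power2_eq_square)
      then have "(D y - D x) / (y - x) / (\<sigma> y + \<sigma> x)
          = ((\<sigma> y - \<sigma> x) / (y - x)) * ((\<sigma> y + \<sigma> x) / (\<sigma> y + \<sigma> x))"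
        by simp
      then show ?case by (simp only: divide_self[OF elim(1)] mult_1_right)
    qed
  qed
  ultimately have "((\<lambda>y. (\<sigma> y - \<sigma> x) / (y - x)) \<longlongrightarrow> poly (pderiv (D_poly k z)) x / (\<sigma> x + \<sigma> x)) (at x)"
    by (rule Lim_transform_eventually)
  then show ?thesis by (simp only: has_field_derivative_iff mult_2)
qed

lemma branch_holomorphic: "local_triv k z V \<sigma> \<Longrightarrow> \<sigma> holomorphic_on V"
  using branch_has_field_derivative local_trivD(1) by (auto simp: holomorphic_on_open)

text \<open>A root continued along a map, such as a path or a uniformizing coordinate, is locally a
  branch defined on the plane composed with that map. This carries derivatives of branches over to
  the continued root.\<close>

lemma lift_eq_branch:
  fixes X S :: "'a :: t2_space \<Rightarrow> complex"
  assumes "isCont X y0" "isCont S y0" "\<forall>\<^sub>F y in nhds y0. (S y)\<^sup>2 = D (X y)" "X y0 \<notin> K"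
  obtains V \<sigma> where "local_triv k z V \<sigma>" "X y0 \<in> V" "\<sigma> (X y0) = S y0"
    "\<forall>\<^sub>F y in nhds y0. S y = \<sigma> (X y)"
proof -
  have "(S y0)\<^sup>2 = D (X y0)" using assms(3) by (rule eventually_nhds_x_imp_x)
  with assms(4) obtain V \<sigma> where V: "local_triv k z V \<sigma>" "X y0 \<in> V" "\<sigma> (X y0) = S y0"
    by (metis exists_branch)
  note T = local_trivD[OF V(1)]
  have "\<forall>\<^sub>F y in nhds y0. X y \<in> V"
    using assms(1) T(1) V(2) by (auto simp: continuous_at_open eventually_nhds)
  with assms(3) have "\<forall>\<^sub>F y in nhds y0. (S y)\<^sup>2 = (\<sigma> (X y))\<^sup>2"
    by eventually_elim (simp add: T(3))
  moreover have "isCont (\<lambda>y. \<sigma> (X y)) y0"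
    using continuous_at_compose[of y0 X \<sigma>] assms(1) T(5)[OF V(2)] by (simp add: o_def)
  ultimately have "\<forall>\<^sub>F y in nhds y0. S y = \<sigma> (X y)"
    using V(3)[symmetric] T(4)[OF V(2)] square_eq_eventually[OF assms(2)] by blast
  with V that show ?thesis by blast
qed


section \<open>Sections with a prescribed differential\<close>

text \<open>This is the equation dH = Re (W / sqrt D dx). Keeping \<open>W\<close>, later taken
  entire, rather than mere harmonicity gives access to regularity in the coordinate at a branch
  point and to analytic continuation.\<close>

definition section_deriv :: "(complex \<Rightarrow> complex \<Rightarrow> real) \<Rightarrow> (complex \<Rightarrow> complex) \<Rightarrow> bool" where
  "section_deriv H W \<longleftrightarrow> (\<forall>V \<sigma> x. local_triv k z V \<sigma> \<longrightarrow> x \<in> V \<longrightarrow>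
     ((\<lambda>y. H y (\<sigma> y)) has_derivative (\<lambda>h. Re (W x / \<sigma> x * h))) (at x))"

lemma section_derivD:
  "section_deriv H W \<Longrightarrow> local_triv k z V \<sigma> \<Longrightarrow> x \<in> V \<Longrightarrow>
    ((\<lambda>y. H y (\<sigma> y)) has_derivative (\<lambda>h. Re (W x / \<sigma> x * h))) (at x)"
  unfolding section_deriv_def by blast

text \<open>Pulls the differential back along a map into the double cover with components
  \<open>X\<close> and \<open>S\<close>; the case of interest is the substitution
  \<open>X y = c + y^2\<close>.\<close>

lemma section_chain:
  fixes X S :: "'a :: real_normed_vector \<Rightarrow> complex"
  assumes H: "section_deriv H W" and X: "(X has_derivative X') (at y0)"
    and S: "isCont S y0" "\<forall>\<^sub>F y in nhds y0. (S y)\<^sup>2 = D (X y)" "X y0 \<notin> K"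
  shows "((\<lambda>y. H (X y) (S y)) has_derivative (\<lambda>h. Re (W (X y0) / S y0 * X' h))) (at y0)"
proof -
  obtain V \<sigma> where V: "local_triv k z V \<sigma>" "X y0 \<in> V" "\<sigma> (X y0) = S y0"
    "\<forall>\<^sub>F y in nhds y0. S y = \<sigma> (X y)"
    using lift_eq_branch[OF has_derivative_continuous[OF X] S] .
  have 1: "((\<lambda>y. H (X y) (\<sigma> (X y))) has_derivative (\<lambda>h. Re (W (X y0) / S y0 * X' h))) (at y0)"
    using has_derivative_compose[OF X section_derivD[OF H V(1,2)]] V(3) by simp
  show ?thesis
    by (rule has_derivative_transform_eventually[OF 1])
      (use V(3,4) in \<open>auto simp: eventually_at_filter elim: eventually_mono\<close>)
qed

section \<open>Uniformization at a branch point\<close>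

text \<open>Cutting along one ray for each other root leaves only the branching of
  \<open>x - c\<close>. The complement \<open>S\<close> of the rays is star-shaped about
  \<open>c\<close>, which serves primitives and straight paths, and dense, which serves extension by
  continuity.\<close>

lemma chart:
  assumes c: "c \<in> K"
  obtains S e where "open S" "c \<in> S" "closure S = UNIV"
    "\<And>x t. x \<in> S \<Longrightarrow> 0 \<le> t \<Longrightarrow> t \<le> 1 \<Longrightarrow> c + of_real t * (x - c) \<in> S"
    "e holomorphic_on S" "\<And>x. x \<in> S \<Longrightarrow> D x = (x - c) * (e x)\<^sup>2" "\<And>x. x \<in> S \<Longrightarrow> e x \<noteq> 0"
proof -
  \<comment> \<open>Since \<open>x - a = (c - a) * q a x\<close>, the product \<open>e\<close>
    collects square roots of the factors \<open>x - a\<close>. The value \<open>q a x\<close> is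
    real and nonpositive exactly on the ray that starts at \<open>a\<close> and points away from
    \<open>c\<close>.\<close>
  define q where "q a x = 1 - (x - c) / (a - c)" for a x
  define S where "S = (\<Inter>a\<in>K - {c}. {x. q a x \<in> - \<real>\<^sub>\<le>\<^sub>0})"
  define e where "e x = (\<Prod>a\<in>K - {c}. csqrt (c - a) * csqrt (q a x))" for x
  have fin: "finite (K - {c})" using finite_K by simp
  have op: "open {x. q a x \<in> - \<real>\<^sub>\<le>\<^sub>0}" if "a \<in> K - {c}" for a
  proof -
    have "continuous_on UNIV (q a)"
      unfolding q_def by (intro continuous_intros) (use that in auto)
    from open_vimage[OF _ this, of "- \<real>\<^sub>\<le>\<^sub>0"] show ?thesis
      by (simp add: vimage_def open_Compl)
  qed
  have "open S" unfolding S_def using fin op by blast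
  moreover have "c \<in> S" by (simp add: S_def q_def)
  moreover have "closure S = UNIV"
  proof -
    \<comment> \<open>Each ray lies on a line with normal \<open>\<i> * (a - c)\<close>, hence is a
      null set; finitely many null sets have a union with empty interior.\<close>
    have "negligible {x. q a x \<in> \<real>\<^sub>\<le>\<^sub>0}" if a: "a \<in> K - {c}" for a
    proof -
      have "{x. q a x \<in> \<real>\<^sub>\<le>\<^sub>0} \<subseteq> {x. (\<i> * (a - c)) \<bullet> x = (\<i> * (a - c)) \<bullet> c}"
      proof clarsimp
        fix x assume "q a x \<in> \<real>\<^sub>\<le>\<^sub>0"
        then have "Im ((x - c) / (a - c)) = 0"
          by (simp add: q_def complex_nonpos_Reals_iff)
        then show "(\<i> * (a - c)) \<bullet> x = (\<i> * (a - c)) \<bullet> c"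
          using a complex_neq_0[of "a - c"]
          by (auto simp: Im_divide inner_complex_def algebra_simps)
      qed
      moreover have "negligible {x. (\<i> * (a - c)) \<bullet> x = (\<i> * (a - c)) \<bullet> c}"
        using a by (intro negligible_hyperplane) auto
      ultimately show ?thesis using negligible_subset by blast
    qed
    then have "negligible (\<Union>a\<in>K - {c}. {x. q a x \<in> \<real>\<^sub>\<le>\<^sub>0})"
      using fin by (intro negligible_Union) auto
    moreover have "interior (- S) \<subseteq> (\<Union>a\<in>K - {c}. {x. q a x \<in> \<real>\<^sub>\<le>\<^sub>0})"
      using interior_subset unfolding S_def by blast
    ultimately have "interior (- S) = {}"
      using negligible_subset open_not_negligible open_interior by blast
    then show ?thesis by (simp add: closure_interior)
  qed
  moreover have "c + of_real t * (x - c) \<in> S" if x: "x \<in> S" and t: "0 \<le> t" "t \<le> 1" for x t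
  proof -
    \<comment> \<open>With \<open>p = (x - c) / (a - c)\<close>, if \<open>t * p\<close> is real and
      at least 1 for some \<open>t\<close> in [0,1], then so is \<open>p\<close>, and
      \<open>x\<close> itself lies on the ray.\<close>
    have "q a (c + of_real t * (x - c)) \<notin> \<real>\<^sub>\<le>\<^sub>0" if a: "a \<in> K - {c}" for a
    proof
      assume *: "q a (c + of_real t * (x - c)) \<in> \<real>\<^sub>\<le>\<^sub>0"
      define p where "p = (x - c) / (a - c)"
      have "q a (c + of_real t * (x - c)) = 1 - of_real t * p" by (simp add: q_def p_def)
      with * have tp: "1 \<le> t * Re p" "t * Im p = 0" by (auto simp: complex_nonpos_Reals_iff)
      then have "t \<noteq> 0" "Im p = 0" by auto
      moreover have "1 \<le> Re p"
      proof (rule ccontr)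
        assume "\<not> 1 \<le> Re p"
        then have "t * Re p < t * 1" using t \<open>t \<noteq> 0\<close> by (intro mult_strict_left_mono) auto
        with tp t show False by simp
      qed
      ultimately have "q a x \<in> \<real>\<^sub>\<le>\<^sub>0" by (simp add: q_def p_def[symmetric] complex_nonpos_Reals_iff)
      with x a show False by (auto simp: S_def)
    qed
    then show ?thesis by (auto simp: S_def)
  qed
  moreover have "e holomorphic_on S"
    unfolding e_def
    by (intro holomorphic_intros) (auto simp: S_def q_def intro!: holomorphic_intros)
  moreover have "D x = (x - c) * (e x)\<^sup>2" for x
  proof -
    have "D x = (x - c) * (\<Prod>a\<in>K - {c}. x - a)"
      using c finite_K by (simp add: D_eq_prod prod.remove)
    also have "(\<Prod>a\<in>K - {c}. x - a) = (\<Prod>a\<in>K - {c}. (csqrt (c - a) * csqrt (q a x))\<^sup>2)"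
    proof (rule prod.cong)
      fix a assume "a \<in> K - {c}"
      then have "c - a \<noteq> 0" "a - c \<noteq> 0" by auto
      then show "x - a = (csqrt (c - a) * csqrt (q a x))\<^sup>2"
        by (simp add: power_mult_distrib q_def divide_simps) (simp add: algebra_simps)
    qed simp
    finally show ?thesis by (simp add: e_def prod_power_distrib)
  qed
  moreover have "e x \<noteq> 0" if "x \<in> S" for x
  proof -
    have "q a x \<noteq> 0" if "a \<in> K - {c}" for a
      using \<open>x \<in> S\<close> that by (force simp: S_def)
    then show ?thesis using fin by (auto simp: e_def)
  qed
  ultimately show ?thesis using that by blast
qed

text \<open>With \<open>x = c + y^2\<close> a root of \<open>D\<close> is \<open>y * e x\<close> and
  dx = 2 y dy, so the factor \<open>y\<close> cancels and W / sqrt D dx becomes 2 W / e dy, regular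
  at \<open>y = 0\<close>. The domain in \<open>y\<close> inherits star-shapedness about 0, with
  ratio \<open>t^2\<close> downstairs for ratio \<open>t\<close> upstairs.\<close>

lemma uniformized_primitive:
  assumes c: "c \<in> K" and W: "W holomorphic_on UNIV"
  obtains S e \<Psi> where "open S" "c \<in> S" "closure S = UNIV"
    "\<And>x t. x \<in> S \<Longrightarrow> 0 \<le> t \<Longrightarrow> t \<le> 1 \<Longrightarrow> c + of_real t * (x - c) \<in> S"
    "e holomorphic_on S" "\<And>x. x \<in> S \<Longrightarrow> D x = (x - c) * (e x)\<^sup>2" "\<And>x. x \<in> S \<Longrightarrow> e x \<noteq> 0"
    "\<And>y. c + y\<^sup>2 \<in> S \<Longrightarrow> (\<Psi> has_field_derivative 2 * W (c + y\<^sup>2) / e (c + y\<^sup>2)) (at y)" "\<Psi> 0 = 0"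
proof -
  obtain S e where S: "open S" "c \<in> S" "closure S = UNIV"
    "\<And>x t. x \<in> S \<Longrightarrow> 0 \<le> t \<Longrightarrow> t \<le> 1 \<Longrightarrow> c + of_real t * (x - c) \<in> S"
    and e: "e holomorphic_on S" "\<And>x. x \<in> S \<Longrightarrow> D x = (x - c) * (e x)\<^sup>2" "\<And>x. x \<in> S \<Longrightarrow> e x \<noteq> 0"
    using chart[OF c] by blast
  define T where "T = {y. c + y\<^sup>2 \<in> S}"
  have "continuous_on UNIV (\<lambda>y. c + y\<^sup>2)" by (intro continuous_intros)
  from open_vimage[OF S(1) this] have opT: "open T" by (simp add: T_def vimage_def)
  have "starlike T"
    unfolding starlike_def
  proof (intro bexI ballI subsetI)
    show "0 \<in> T" using S(2) by (simp add: T_def)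
    fix y w assume y: "y \<in> T" and "w \<in> closed_segment 0 y"
    then obtain t where t: "0 \<le> t" "t \<le> 1" "w = of_real t * y"
      by (auto simp: in_segment scaleR_conv_of_real)
    have "t\<^sup>2 \<le> 1" using t by (simp add: power_le_one)
    with S(4)[of "c + y\<^sup>2" "t\<^sup>2"] y t show "w \<in> T"
      by (simp add: T_def power_mult_distrib)
  qed
  moreover have hol: "(\<lambda>y. 2 * W (c + y\<^sup>2) / e (c + y\<^sup>2)) holomorphic_on T"
    by (intro holomorphic_intros holomorphic_on_compose_gen[OF _ W, unfolded o_def]
          holomorphic_on_compose_gen[OF _ e(1), unfolded o_def])
      (auto simp: T_def e(3))
  ultimately obtain g where g: "\<And>y. y \<in> T \<Longrightarrow> (g has_field_derivative 2 * W (c + y\<^sup>2) / e (c + y\<^sup>2)) (at y)"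
    using holomorphic_starlike_primitive[OF holomorphic_on_imp_continuous_on[OF hol] _ opT, of "{}"] opT
    by (auto simp: holomorphic_on_imp_differentiable_at)
  show ?thesis
  proof (rule that[OF S e])
    show "((\<lambda>y. g y - g 0) has_field_derivative 2 * W (c + y\<^sup>2) / e (c + y\<^sup>2)) (at y)"
      if "c + y\<^sup>2 \<in> S" for y
      using g[of y] that by (auto simp: T_def intro!: derivative_eq_intros)
  qed simp_all
qed

text \<open>In the coordinate \<open>y\<close> the section is \<open>Re \<Psi> + C\<close>. Passing
  from \<open>y\<close> to \<open>- y\<close> exchanges the sheets over the same point, so the
  section is odd in \<open>y\<close> and \<open>C = 0\<close>.\<close>

lemma tendsto_0_at_branch_point:
  assumes H: "section_deriv H W" "is_section k z H" and W: "W holomorphic_on UNIV"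
    and c: "c \<in> K" and \<epsilon>: "\<epsilon> > 0"
  shows "\<exists>\<rho>>0. \<forall>x w. 0 < dist x c \<and> dist x c < \<rho> \<and> w\<^sup>2 = D x \<longrightarrow> \<bar>H x w\<bar> < \<epsilon>"
proof -
  obtain S e \<Psi> where S: "open S" "c \<in> S"
    and e: "e holomorphic_on S" "\<And>x. x \<in> S \<Longrightarrow> D x = (x - c) * (e x)\<^sup>2" "\<And>x. x \<in> S \<Longrightarrow> e x \<noteq> 0"
    and \<Psi>: "\<And>y. c + y\<^sup>2 \<in> S \<Longrightarrow> (\<Psi> has_field_derivative 2 * W (c + y\<^sup>2) / e (c + y\<^sup>2)) (at y)" "\<Psi> 0 = 0"
    by (rule uniformized_primitive[OF c W]) blast
  have "isCont (\<lambda>y. c + y\<^sup>2) 0" by (intro continuous_intros)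
  with S have "\<forall>\<^sub>F y in nhds 0. c + y\<^sup>2 \<in> S"
    by (auto simp: continuous_at_open eventually_nhds)
  then obtain r where r: "r > 0" "\<And>y. norm y < r \<Longrightarrow> c + y\<^sup>2 \<in> S"
    unfolding eventually_nhds_metric by auto
  let ?B = "ball (0::complex) r - {0}"
  define \<psi> where "\<psi> y = H (c + y\<^sup>2) (y * e (c + y\<^sup>2))" for y
  have notK: "c + y\<^sup>2 \<notin> K" if "y \<in> ?B" for y
    using that r(2)[of y] e(2,3)[of "c + y\<^sup>2"] by (auto simp: D_eq_0_iff[symmetric])
  have sq: "(y * e (c + y\<^sup>2))\<^sup>2 = D (c + y\<^sup>2)" if "y \<in> ?B" for y
    using that r(2)[of y] e(2)[of "c + y\<^sup>2"] by (simp add: power_mult_distrib)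
  have opB: "open ?B" by (intro open_Diff) auto
  have der: "(\<psi> has_derivative (\<lambda>h. Re (2 * W (c + y\<^sup>2) / e (c + y\<^sup>2) * h))) (at y)" if y: "y \<in> ?B" for y
  proof -
    have inS: "c + y\<^sup>2 \<in> S" using y r(2) by simp
    have X: "((\<lambda>y. c + y\<^sup>2) has_derivative (\<lambda>h. 2 * y * h)) (at y)"
      by (auto intro!: derivative_eq_intros)
    have "isCont e (c + y\<^sup>2)"
      using e(1) S(1) inS continuous_on_eq_continuous_at holomorphic_on_imp_continuous_on by blast
    then have cont: "isCont (\<lambda>y. y * e (c + y\<^sup>2)) y"
      using continuous_at_compose[of y "\<lambda>y. c + y\<^sup>2" e] by (auto simp: o_def intro!: continuous_intros)
    have ev: "\<forall>\<^sub>F y in nhds y. (y * e (c + y\<^sup>2))\<^sup>2 = D (c + y\<^sup>2)"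
      using eventually_nhds_in_open[OF opB y] by eventually_elim (rule sq)
    show ?thesis
      unfolding \<psi>_def
      using section_chain[OF H(1) X cont ev notK[OF y]] y e(3)[OF inS] by (simp add: field_simps)
  qed
  obtain y0 where y0: "y0 \<in> ?B"
    using r(1) by (intro that[of "of_real (r/2)"]) auto
  have const: "\<psi> y - Re (\<Psi> y) = \<psi> y0 - Re (\<Psi> y0)" if "y \<in> ?B" for y
  proof (rule has_derivative_zero_unique_connected[OF opB])
    show "connected ?B" by (rule connected_punctured_ball) simp
    fix y assume y: "y \<in> ?B"
    then have "((\<lambda>x. Re (\<Psi> x)) has_derivative (\<lambda>h. Re (2 * W (c + y\<^sup>2) / e (c + y\<^sup>2) * h))) (at y)"
      using \<Psi>(1)[OF r(2), of y] unfolding has_field_derivative_def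
      by (intro has_derivative_Re) (simp del: times_divide_eq_left)
    from has_derivative_diff[OF der[OF y] this]
    show "((\<lambda>y. \<psi> y - Re (\<Psi> y)) has_derivative (\<lambda>h. 0)) (at y)" by simp
  qed (use that y0 in auto)
  define C where "C = \<psi> y0 - Re (\<Psi> y0)"
  have odd: "\<psi> (- y) = - \<psi> y" if y: "y \<in> ?B" for y
    using H(2) notK[OF y] sq[OF y] by (simp add: \<psi>_def is_section_def)
  have \<Psi>0: "isCont \<Psi> 0" using \<Psi>(1)[of 0] S(2) DERIV_isCont by auto
  have \<Psi>lim: "(\<Psi> \<longlongrightarrow> 0) (at 0)" using \<Psi>0 \<Psi>(2) by (simp add: isCont_def)
  have \<Psi>lim': "((\<lambda>y. \<Psi> (- y)) \<longlongrightarrow> 0) (at 0)"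
    using isCont_tendsto_compose[OF \<Psi>0, of uminus "at 0"] \<Psi>(2)
      tendsto_minus[OF tendsto_ident_at[of "0::complex" UNIV]] by simp
  \<comment> \<open>Oddness fixes this sum at \<open>- 2 * C\<close>, whereas continuity sends it to
    0.\<close>
  have "((\<lambda>y. Re (\<Psi> y) + Re (\<Psi> (- y))) \<longlongrightarrow> Re 0 + Re 0) (at 0)"
    by (intro tendsto_intros \<Psi>lim \<Psi>lim')
  moreover have "\<forall>\<^sub>F y in at 0. Re (\<Psi> y) + Re (\<Psi> (- y)) = - 2 * C"
    unfolding eventually_at
  proof (intro exI[of _ r] conjI ballI impI)
    fix y :: complex assume "y \<noteq> 0 \<and> dist y 0 < r"
    then have "y \<in> ?B" "- y \<in> ?B" by auto
    with const[of y] const[of "- y"] odd[of y] show "Re (\<Psi> y) + Re (\<Psi> (- y)) = - 2 * C"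
      by (simp add: C_def)
  qed (use r in auto)
  ultimately have "((\<lambda>y::complex. - 2 * C) \<longlongrightarrow> 0) (at 0)"
    using tendsto_cong by force
  then have C0: "C = 0" by (simp add: tendsto_const_iff)
  have "\<forall>\<^sub>F y in nhds 0. dist (\<Psi> y) 0 < \<epsilon>"
    using \<Psi>lim \<Psi>(2) \<epsilon> tendstoD[of \<Psi> 0 "at 0" \<epsilon>] by (auto simp: eventually_at_filter elim: eventually_mono)
  then obtain d where d: "d > 0" "\<And>y. norm y < d \<Longrightarrow> norm (\<Psi> y) < \<epsilon>"
    unfolding eventually_nhds_metric by auto
  \<comment> \<open>A disk of radius \<open>m\<close> in \<open>y\<close> covers the disk of radius
    \<open>m^2\<close> in \<open>x\<close>, and both roots over \<open>x\<close> give the same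
    absolute value.\<close>
  define m where "m = min r d"
  have m: "m > 0" using r d by (simp add: m_def)
  have "\<bar>H x w\<bar> < \<epsilon>" if x: "0 < dist x c" "dist x c < m\<^sup>2" and w: "w\<^sup>2 = D x" for x w
  proof -
    define y where "y = csqrt (x - c)"
    have y2: "x = c + y\<^sup>2" by (simp add: y_def)
    have "(norm y)\<^sup>2 < m\<^sup>2" using x by (simp add: y2 dist_norm norm_power)
    then have "norm y < m" using m power2_less_imp_less by (metis less_imp_le)
    then have yB: "y \<in> ?B" "norm y < d" using x by (auto simp: y2 m_def)
    have "w\<^sup>2 = (y * e (c + y\<^sup>2))\<^sup>2" using w sq[OF yB(1)] y2 by simp
    then have "w = y * e (c + y\<^sup>2) \<or> w = - (y * e (c + y\<^sup>2))" by (simp add: power2_eq_iff)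
    moreover have "H x (- (y * e (c + y\<^sup>2))) = - H x (y * e (c + y\<^sup>2))"
      using H(2) notK[OF yB(1)] sq[OF yB(1)] y2 by (simp add: is_section_def)
    ultimately have "\<bar>H x w\<bar> = \<bar>\<psi> y\<bar>" using y2 by (auto simp: \<psi>_def)
    also have "\<psi> y = Re (\<Psi> y)" using const[OF yB(1)] C0 by (simp add: C_def)
    also have "\<bar>Re (\<Psi> y)\<bar> < \<epsilon>" using d(2)[OF yB(2)] abs_Re_le_cmod[of "\<Psi> y"] by linarith
    finally show ?thesis .
  qed
  then show ?thesis using m by (intro exI[of _ "m\<^sup>2"]) auto
qed

end

section \<open>Vanishing of bounded sections\<close>

lemma has_derivative_ln_cmod:
  assumes "x \<noteq> 0"
  shows "((\<lambda>x. ln (cmod x)) has_derivative (\<lambda>h. Re (h / x))) (at x)"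
proof -
  have "(cmod has_derivative (\<lambda>h. x \<bullet> h / cmod x)) (at x)"
    using has_derivative_norm[OF assms] by (simp add: sgn_div_norm divide_inverse_commute inner_commute)
  moreover have "(ln has_derivative (\<lambda>t. inverse (cmod x) * t)) (at (cmod x))"
    using assms DERIV_ln[of "cmod x"] by (simp add: has_field_derivative_def)
  ultimately have "((\<lambda>x. ln (cmod x)) has_derivative (\<lambda>h. inverse (cmod x) * (x \<bullet> h / cmod x))) (at x)"
    by (rule has_derivative_compose)
  moreover have "inverse (cmod x) * (x \<bullet> h / cmod x) = Re (h / x)" for h
    by (simp add: Re_divide inner_complex_def cmod_power2[symmetric])
      (simp add: power2_eq_square field_simps)
  ultimately show ?thesis by simp
qed

context branch_points
begin

text \<open>At \<open>z 1\<close> the square of \<open>f\<close> has derivative 0, while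
  \<open>\<delta> * D\<close> has derivative \<open>\<delta> * (e (z 1))^2\<close> with
  \<open>e (z 1)\<close> nonzero.\<close>

lemma square_not_const_times_D:
  assumes f: "f holomorphic_on UNIV" and f2: "\<And>x. (f x)\<^sup>2 = \<delta> * D x"
  shows "\<delta> = 0"
proof -
  let ?c = "z 1"
  obtain S e where S: "open S" "?c \<in> S"
    and e: "e holomorphic_on S" "\<And>x. x \<in> S \<Longrightarrow> D x = (x - ?c) * (e x)\<^sup>2" "\<And>x. x \<in> S \<Longrightarrow> e x \<noteq> 0"
    by (rule chart[OF z1_in_K]) blast
  have "f ?c = 0" using f2[of ?c] D_eq_0_iff[THEN iffD2, OF z1_in_K] by simp
  moreover have df: "(f has_field_derivative deriv f ?c) (at ?c)"
    using f holomorphic_derivI by blast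
  ultimately have "((\<lambda>x. (f x)\<^sup>2) has_field_derivative 0) (at ?c)"
    by (auto intro!: derivative_eq_intros)
  moreover have "(e has_field_derivative deriv e ?c) (at ?c)"
    using e(1) S holomorphic_derivI by blast
  then have "((\<lambda>x. \<delta> * ((x - ?c) * (e x)\<^sup>2)) has_field_derivative \<delta> * (e ?c)\<^sup>2) (at ?c)"
    by (auto intro!: derivative_eq_intros)
  then have "((\<lambda>x. (f x)\<^sup>2) has_field_derivative \<delta> * (e ?c)\<^sup>2) (at ?c)"
    by (rule has_field_derivative_transform_within_open[OF _ S]) (simp add: f2 e(2))
  ultimately have "\<delta> * (e ?c)\<^sup>2 = 0" using DERIV_unique by blast
  then show ?thesis using e(3)[OF S(2)] by simp
qed

text \<open>The maximum principle gives zeros of \<open>W\<close> on a whole ball, and the identity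
  theorem spreads them over the plane.\<close>

lemma section_deriv_max_imp_zero:
  assumes H: "section_deriv H W" and W: "W holomorphic_on UNIV" and t: "local_triv k z V \<sigma>" "x0 \<in> V"
    and max: "\<And>x. x \<in> V \<Longrightarrow> H x (\<sigma> x) \<le> H x0 (\<sigma> x0)"
  shows "W x = 0"
proof -
  note T = local_trivD[OF t(1)]
  have "(\<lambda>x. W x / \<sigma> x) holomorphic_on V"
    using branch_holomorphic[OF t(1)] T(4) W by (auto intro!: holomorphic_intros intro: holomorphic_on_subset)
  then obtain r where r: "r > 0" "ball x0 r \<subseteq> V" "\<And>x. x \<in> ball x0 r \<Longrightarrow> W x / \<sigma> x = 0"
    using harmonic_max_imp_zero[OF T(1) t(2) _ section_derivD[OF H t(1)] max] by blast
  show ?thesis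
  proof (rule analytic_continuation_open[of "ball x0 r" UNIV W "\<lambda>_. 0"])
    show "W y = 0" if "y \<in> ball x0 r" for y
      using r(3)[OF that] T(4)[of y] r(2) that by auto
  qed (use W r(1) in auto)
qed

text \<open>
  A Phragmen-Lindelof argument: subtracting \<open>\<delta> ln |x|\<close> makes the bounded function attain its maximum, and the
  strong maximum principle would force \<open>(x W x)\<^sup>2 = \<delta>\<^sup>2 D x\<close>, impossible because \<open>D\<close> has simple zeros.
\<close>

lemma exterior_bound:
  assumes H: "section_deriv H W" and W: "W holomorphic_on UNIV"
    and t: "local_triv k z {x. cmod x > R} \<sigma>"
    and bd: "\<And>x. cmod x > r1 \<Longrightarrow> H x (\<sigma> x) \<le> B"
    and r: "r > R" "r > 0" and M: "\<And>x. cmod x = r \<Longrightarrow> H x (\<sigma> x) \<le> M" and x: "cmod x \<ge> r"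
  shows "H x (\<sigma> x) \<le> M"
proof -
  have *: "H x (\<sigma> x) - \<delta> * ln (cmod x / r) \<le> M" if \<delta>: "\<delta> > 0" for \<delta>
  proof (rule ccontr)
    define v where "v y = H y (\<sigma> y) - \<delta> * ln (cmod y / r)" for y
    assume "\<not> ?thesis"
    then have vx: "v x > M" by (simp add: v_def)
    \<comment> \<open>The first entry makes \<open>\<delta> * ln (r2 / r)\<close> at least
      \<open>B - M\<close>, so \<open>v\<close> is at most \<open>M\<close> on the outer circle; the
      others make \<open>B\<close> valid there and put \<open>x\<close> inside.\<close>
    define r2 where "r2 = Max {r * exp ((B - M) / \<delta>), r1 + 1, cmod x + 1}"
    have r2: "r2 \<ge> r * exp ((B - M) / \<delta>)" "r2 > r1" "r2 > cmod x" by (auto simp: r2_def)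
    let ?A = "cball 0 r2 - ball 0 r :: complex set"
    let ?O = "ball 0 r2 - cball 0 r :: complex set"
    have der: "(v has_derivative (\<lambda>h. Re ((W y / \<sigma> y - of_real \<delta> / y) * h))) (at y)" if "cmod y > R" "y \<noteq> 0" for y
    proof -
      have 1: "((\<lambda>y. H y (\<sigma> y)) has_derivative (\<lambda>h. Re (W y / \<sigma> y * h))) (at y)"
        using section_derivD[OF H t, of y] that by simp
      have 2: "((\<lambda>y. H y (\<sigma> y) - \<delta> * (ln (cmod y) - ln r))
           has_derivative (\<lambda>h. Re (W y / \<sigma> y * h) - \<delta> * (Re (h / y) - 0))) (at y)"
        by (intro has_derivative_diff has_derivative_mult_right 1 has_derivative_ln_cmod that(2)
              has_derivative_const)
      have 3: "Re (W y / \<sigma> y * h) - \<delta> * (Re (h / y) - 0) = Re ((W y / \<sigma> y - of_real \<delta> / y) * h)" for h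
      proof -
        have "of_real \<delta> / y * h = \<delta> *\<^sub>R (h / y)" by (simp add: scaleR_conv_of_real)
        then show ?thesis by (simp only: left_diff_distrib minus_complex.sel scaleR_complex.sel) simp
      qed
      show ?thesis
        by (rule has_derivative_transform_within_open[OF 2[unfolded 3], of "- {0}"])
          (use that r in \<open>auto simp: v_def ln_div\<close>)
    qed
    have "continuous_on ?A v"
    proof (intro continuous_at_imp_continuous_on ballI)
      fix y assume "y \<in> ?A"
      then have "cmod y > R" "y \<noteq> 0" using r by auto
      then show "isCont v y" by (rule has_derivative_continuous[OF der])
    qed
    moreover have "compact ?A" by (intro compact_diff) auto
    moreover have "x \<in> ?A" using x r2 by auto
    ultimately obtain x2 where x2: "x2 \<in> ?A" "\<And>y. y \<in> ?A \<Longrightarrow> v y \<le> v x2"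
      using continuous_attains_sup[of ?A v] by blast
    have "v x2 > M" using x2(2)[OF \<open>x \<in> ?A\<close>] vx by simp
    have "cmod x2 \<noteq> r"
      using M[of x2] \<open>v x2 > M\<close> r by (auto simp: v_def)
    moreover have "cmod x2 \<noteq> r2"
    proof
      assume c: "cmod x2 = r2"
      have "(B - M) / \<delta> = ln (r * exp ((B - M) / \<delta>) / r)" using r by simp
      also have "\<dots> \<le> ln (cmod x2 / r)"
        using r r2 c by (intro ln_mono divide_right_mono) (auto intro!: divide_pos_pos)
      finally have "B - M \<le> \<delta> * ln (cmod x2 / r)" using \<delta> by (simp add: field_simps)
      with bd[of x2] c r2 \<open>v x2 > M\<close> show False by (simp add: v_def)
    qed
    ultimately have x2O: "x2 \<in> ?O" using x2(1) by auto
    have "(\<lambda>y. W y / \<sigma> y - of_real \<delta> / y) holomorphic_on ?O"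
      using W branch_holomorphic[OF t] local_trivD(4)[OF t] r
      by (auto intro!: holomorphic_intros intro: holomorphic_on_subset)
    moreover have "open ?O" by (intro open_Diff) auto
    moreover have "(v has_derivative (\<lambda>h. Re ((W y / \<sigma> y - of_real \<delta> / y) * h))) (at y)" if "y \<in> ?O" for y
      by (rule der) (use that r in auto)
    moreover have "v y \<le> v x2" if "y \<in> ?O" for y
      by (rule x2(2)) (use that in auto)
    ultimately obtain \<rho> where \<rho>: "\<rho> > 0" "ball x2 \<rho> \<subseteq> ?O"
      and zero: "\<And>y. y \<in> ball x2 \<rho> \<Longrightarrow> W y / \<sigma> y - of_real \<delta> / y = 0"
      using harmonic_max_imp_zero[of ?O x2 "\<lambda>y. W y / \<sigma> y - of_real \<delta> / y" v] x2O by blast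
    \<comment> \<open>Squaring \<open>W y / \<sigma> y = \<delta> / y\<close> removes the branch and
      leaves an identity of entire functions.\<close>
    have "(y * W y)\<^sup>2 = of_real (\<delta>\<^sup>2) * D y" for y
    proof (rule analytic_continuation_open[of "ball x2 \<rho>" UNIV
          "\<lambda>y. (y * W y)\<^sup>2" "\<lambda>y. of_real (\<delta>\<^sup>2) * D y"])
      fix y assume y: "y \<in> ball x2 \<rho>"
      then have "y \<in> ?O" using \<rho>(2) by blast
      then have "cmod y > R" "y \<noteq> 0" using r by auto
      then have "\<sigma> y \<noteq> 0" "(\<sigma> y)\<^sup>2 = D y" using local_trivD[OF t] by auto
      moreover from zero[OF y] have "y * W y = of_real \<delta> * \<sigma> y"
        using \<open>\<sigma> y \<noteq> 0\<close> \<open>y \<noteq> 0\<close> by (simp add: field_simps)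
      ultimately show "(y * W y)\<^sup>2 = of_real (\<delta>\<^sup>2) * D y"
        by (simp add: power_mult_distrib)
    qed (use W \<rho> in \<open>auto intro!: holomorphic_intros\<close>)
    then have "of_real (\<delta>\<^sup>2) = (0::complex)"
      by (intro square_not_const_times_D[of "\<lambda>y. y * W y"] holomorphic_intros W)
    with \<delta> show False by simp
  qed
  show ?thesis
  proof (rule field_le_epsilon)
    fix \<epsilon> :: real assume \<epsilon>: "\<epsilon> > 0"
    \<comment> \<open>The choice \<open>\<delta> = \<epsilon> / (L + 1)\<close> keeps the correction
      below \<open>\<epsilon>\<close>; the added 1 covers \<open>L = 0\<close>.\<close>
    define L where "L = ln (cmod x / r)"
    have L: "L \<ge> 0" using x r by (simp add: L_def)
    have "H x (\<sigma> x) - \<epsilon> / (L + 1) * L \<le> M"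
      using *[of "\<epsilon> / (L + 1)"] \<epsilon> L by (simp add: L_def)
    moreover have "\<epsilon> / (L + 1) * L \<le> \<epsilon>" using \<epsilon> L by (simp add: field_simps)
    ultimately show "H x (\<sigma> x) \<le> M + \<epsilon>" by linarith
  qed
qed

text \<open>Only the absolute value of \<open>H\<close> descends to the plane, as the function
  \<open>h\<close>. Applying \<open>exterior_bound\<close> to both branches \<open>\<sigma>\<close>
  and \<open>- \<sigma>\<close> turns the maximum of \<open>h\<close> over a disk into a global one,
  and on a suitable sheet it is a maximum of \<open>H\<close> itself.\<close>

theorem bounded_section_deriv_eq_0:
  assumes H: "section_deriv H W" "is_section k z H" and W: "W holomorphic_on UNIV"
    and t: "local_triv k z {x. cmod x > R} \<sigma>"
    and bd: "\<And>x. cmod x > r1 \<Longrightarrow> \<bar>H x (\<sigma> x)\<bar> \<le> B"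
  shows "W x = 0"
proof -
  define h where "h x = (if x \<in> K then 0 else \<bar>H x (csqrt (D x))\<bar>)" for x
  have odd: "H x (- w) = - H x w" if "x \<notin> K" "w\<^sup>2 = D x" for x w
    using H(2) that by (simp add: is_section_def)
  have h_eq: "\<bar>H x w\<bar> = h x" if x: "x \<notin> K" "w\<^sup>2 = D x" for x w
  proof -
    have "w\<^sup>2 = (csqrt (D x))\<^sup>2" using x by simp
    then have "w = csqrt (D x) \<or> w = - csqrt (D x)" by (simp only: power2_eq_iff)
    then show ?thesis using odd[OF x(1), of "csqrt (D x)"] x(1) by (auto simp: h_def)
  qed
  have "isCont h a" for a
  proof (cases "a \<in> K")
    case False
    then obtain V s where V: "local_triv k z V s" "a \<in> V"
      by (metis exists_branch power2_csqrt)
    note T = local_trivD[OF V(1)]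
    have "isCont (\<lambda>y. \<bar>H y (s y)\<bar>) a"
      using has_derivative_continuous[OF section_derivD[OF H(1) V]] by (intro continuous_intros)
    moreover have "\<forall>\<^sub>F y in nhds a. \<bar>H y (s y)\<bar> = h y"
      using eventually_nhds_in_open[OF T(1) V(2)] by eventually_elim (use h_eq T in blast)
    ultimately show ?thesis by (simp add: isCont_cong)
  next
    case True
    have "h \<midarrow>a\<rightarrow> 0"
    proof (rule tendstoI)
      fix \<epsilon> :: real assume \<epsilon>: "\<epsilon> > 0"
      obtain \<rho> where "\<rho> > 0" "\<And>x w. 0 < dist x a \<Longrightarrow> dist x a < \<rho> \<Longrightarrow> w\<^sup>2 = D x \<Longrightarrow> \<bar>H x w\<bar> < \<epsilon>"
        using tendsto_0_at_branch_point[OF H W True \<epsilon>] by blast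
      then show "\<forall>\<^sub>F x in at a. dist (h x) 0 < \<epsilon>"
        unfolding eventually_at using \<epsilon> by (intro exI[of _ \<rho>]) (auto simp: h_def)
    qed
    with True show ?thesis by (simp add: isCont_def h_def)
  qed
  then have cont: "continuous_on A h" for A
    by (simp add: continuous_at_imp_continuous_on)
  define r where "r = Max {R + 1, 1}"
  have r: "r > R" "r > 0" by (auto simp: r_def less_max_iff_disj)
  obtain x1 where x1: "x1 \<in> cball 0 r" "\<And>y. y \<in> cball 0 r \<Longrightarrow> h y \<le> h x1"
    using continuous_attains_sup[OF compact_cball _ cont, of 0 r] r by force
  have Vext: "x \<notin> K" "(\<sigma> x)\<^sup>2 = D x" if "cmod x > R" for x
    using local_trivD[OF t] that by auto
  have hmax: "h y \<le> h x1" for y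
  proof (cases "cmod y \<le> r")
    case True then show ?thesis using x1 by simp
  next
    case False
    have M: "\<bar>H x (\<sigma> x)\<bar> \<le> h x1" if "cmod x = r" for x
      using h_eq[OF Vext] x1(2)[of x] that r by simp
    have "H y (\<sigma> y) \<le> h x1"
      by (rule exterior_bound[OF H(1) W t _ r, of r1 B]) (use bd M False in \<open>auto dest: abs_le_D1\<close>)
    moreover have "H y (- \<sigma> y) \<le> h x1"
    proof (rule exterior_bound[OF H(1) W local_triv_minus[OF t] _ r])
      show "H x (- \<sigma> x) \<le> B" if "cmod x > max r1 R" for x
        using that odd[OF Vext] bd[of x] by (auto simp: abs_le_iff)
      show "H x (- \<sigma> x) \<le> h x1" if "cmod x = r" for x
        using odd[OF Vext] M[OF that] that r by (auto simp: abs_le_iff)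
    qed (use False in auto)
    ultimately show ?thesis
      using h_eq[OF Vext, of y] odd[OF Vext, of y] False r by auto
  qed
  \<comment> \<open>A maximum located in \<open>K\<close> has value 0, so \<open>h\<close> vanishes
    identically and any exterior point is a maximum as well.\<close>
  obtain x0 where x0: "x0 \<notin> K" "\<And>y. h y \<le> h x0"
  proof (cases "x1 \<in> K")
    case False with hmax that show ?thesis by blast
  next
    case True
    then have "h y \<le> 0" for y using hmax[of y] by (simp add: h_def)
    moreover have "of_real (\<bar>R\<bar> + 1) \<notin> K" by (rule Vext) auto
    ultimately show ?thesis using that[of "of_real (\<bar>R\<bar> + 1)"]
      by (metis abs_ge_zero h_def order_trans)
  qed
  \<comment> \<open>Of the two roots over \<open>x0\<close>, the one with a nonnegative value of
    \<open>H\<close> is taken.\<close>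
  obtain w0 where w0: "w0\<^sup>2 = D x0" "H x0 w0 = h x0"
    using odd[OF x0(1), of "csqrt (D x0)"] x0(1) that[of "csqrt (D x0)"] that[of "- csqrt (D x0)"]
    by (cases "H x0 (csqrt (D x0)) \<ge> 0") (auto simp: h_def)
  obtain V s where V: "local_triv k z V s" "x0 \<in> V" "s x0 = w0"
    by (rule exists_branch[OF x0(1) w0(1)])
  show ?thesis
  proof (rule section_deriv_max_imp_zero[OF H(1) W V(1,2)])
    fix y assume "y \<in> V"
    then have "\<bar>H y (s y)\<bar> = h y" using local_trivD[OF V(1)] h_eq by blast
    then show "H y (s y) \<le> H x0 (s x0)" using x0(2)[of y] w0(2) V(3) by simp
  qed
qed

end

section \<open>Abel integrals\<close>

lemma continuous_eq_0_of_dense: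
  fixes f :: "'a :: topological_space \<Rightarrow> 'b :: real_normed_vector"
  assumes "open V" "continuous_on V f" "closure S = UNIV" "\<And>x. x \<in> V \<inter> S \<Longrightarrow> f x = 0" "x \<in> V"
  shows "f x = 0"
proof (rule ccontr)
  assume nz: "f x \<noteq> 0"
  have op: "open (f -` (- {0}) \<inter> V)"
    using assms(1,2) by (simp add: continuous_on_open_vimage open_Compl)
  have "(f -` (- {0}) \<inter> V) \<inter> S = {}" using assms(4) by auto
  then have "(f -` (- {0}) \<inter> V) \<inter> closure S = {}" using open_Int_closure_eq_empty[OF op] by blast
  with nz assms(3,5) show False by auto
qed

context branch_points
begin

lemma abel_integral_minus:
  assumes "abel_integral k z u x w A"
  shows "abel_integral k z u x (- w) (- A)"
proof -
  obtain \<gamma> s where *: "valid_path \<gamma>" "pathstart \<gamma> = z 1" "pathfinish \<gamma> = x"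
    "\<forall>t\<in>{0<..<1}. \<gamma> t \<notin> K" "continuous_on {0..1} s"
    "\<forall>t\<in>{0..1}. (s t)\<^sup>2 = D (\<gamma> t)" "s 1 = w"
    "((\<lambda>t. u (\<gamma> t) / s t * vector_derivative \<gamma> (at t within {0..1})) has_integral A) {0..1}"
    using assms unfolding abel_integral_def by blast
  show ?thesis
    unfolding abel_integral_def
    by (rule exI[of _ \<gamma>], rule exI[of _ "\<lambda>t. - s t"])
      (use * has_integral_neg[OF *(8)] in \<open>auto intro!: continuous_on_minus\<close>)
qed

text \<open>The quotient \<open>\<sigma> / e\<close> is a branch of the root of
  \<open>x - z 1\<close>, that is, the coordinate \<open>y\<close>, so
  \<open>\<Psi> (\<sigma> x / e x)\<close> is a value of the Abel integral along the segment from
  \<open>z 1\<close>. The cuts restrict this to a dense set.\<close>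

lemma abel_integral_on_dense:
  assumes U: "U holomorphic_on UNIV"
  obtains S where "open S" "closure S = UNIV"
    "\<And>V \<sigma>. local_triv k z V \<sigma> \<Longrightarrow> \<exists>F. \<forall>x\<in>V \<inter> S.
       abel_integral k z U x (\<sigma> x) (F x) \<and> (F has_field_derivative U x / \<sigma> x) (at x)"
proof -
  let ?c = "z 1"
  obtain S e \<Psi> where S: "open S" "?c \<in> S" "closure S = UNIV"
    and star: "\<And>x t. x \<in> S \<Longrightarrow> 0 \<le> t \<Longrightarrow> t \<le> 1 \<Longrightarrow> ?c + of_real t * (x - ?c) \<in> S"
    and e: "e holomorphic_on S" "\<And>x. x \<in> S \<Longrightarrow> D x = (x - ?c) * (e x)\<^sup>2" "\<And>x. x \<in> S \<Longrightarrow> e x \<noteq> 0"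
    and \<Psi>: "\<And>y. ?c + y\<^sup>2 \<in> S \<Longrightarrow> (\<Psi> has_field_derivative 2 * U (?c + y\<^sup>2) / e (?c + y\<^sup>2)) (at y)" "\<Psi> 0 = 0"
    by (rule uniformized_primitive[OF z1_in_K U]) blast
  have "\<exists>F. \<forall>x\<in>V \<inter> S. abel_integral k z U x (\<sigma> x) (F x) \<and> (F has_field_derivative U x / \<sigma> x) (at x)"
    if t: "local_triv k z V \<sigma>" for V \<sigma>
  proof (intro exI[of _ "\<lambda>x. \<Psi> (\<sigma> x / e x)"] ballI conjI)
    fix x assume x: "x \<in> V \<inter> S"
    note T = local_trivD[OF t]
    define \<omega> where "\<omega> x = \<sigma> x / e x" for x
    have \<omega>2: "(\<omega> y)\<^sup>2 = y - ?c" if "y \<in> V \<inter> S" for y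
      using T(3)[of y] e(2,3)[of y] that by (simp add: \<omega>_def power_divide)
    have \<omega>0: "\<omega> x \<noteq> 0" using T(4)[of x] e(3)[of x] x by (simp add: \<omega>_def)
    have opVS: "open (V \<inter> S)" using T(1) S(1) by blast
    have "\<omega> holomorphic_on V \<inter> S"
      unfolding \<omega>_def using branch_holomorphic[OF t] e
      by (auto intro!: holomorphic_intros intro: holomorphic_on_subset)
    then have d\<omega>: "(\<omega> has_field_derivative deriv \<omega> x) (at x)"
      using holomorphic_derivI opVS x by blast
    have "((\<lambda>y. (\<omega> y)\<^sup>2) has_field_derivative 2 * \<omega> x * deriv \<omega> x) (at x)"
      by (auto intro!: derivative_eq_intros d\<omega>)
    moreover have "((\<lambda>y. (\<omega> y)\<^sup>2) has_field_derivative 1) (at x)"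
      by (rule has_field_derivative_transform_within_open[of "\<lambda>y. y - ?c", OF _ opVS x])
        (auto intro!: derivative_eq_intros simp: \<omega>2)
    ultimately have d1: "2 * \<omega> x * deriv \<omega> x = 1" by (rule DERIV_unique)
    have cx: "?c + (\<omega> x)\<^sup>2 = x" using \<omega>2[OF x] by simp
    have "((\<lambda>x. \<Psi> (\<omega> x)) has_field_derivative 2 * U x / e x * deriv \<omega> x) (at x)"
      using DERIV_chain2[OF \<Psi>(1) d\<omega>] cx x by simp
    also have "2 * U x / e x * deriv \<omega> x = U x / \<sigma> x"
    proof -
      have "\<sigma> x = \<omega> x * e x" using e(3)[of x] x by (simp add: \<omega>_def)
      moreover have "deriv \<omega> x = 1 / (2 * \<omega> x)" using d1 \<omega>0 by (simp add: field_simps)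
      ultimately show ?thesis using \<omega>0 e(3)[of x] x by (simp add: field_simps)
    qed
    finally show "((\<lambda>x. \<Psi> (\<sigma> x / e x)) has_field_derivative U x / \<sigma> x) (at x)"
      by (simp add: \<omega>_def)
    \<comment> \<open>Upstairs this is the straight path \<open>t * \<omega> x\<close>. Its speed
      downstairs and the root \<open>s\<close> both vanish to first order at \<open>t = 0\<close>,
      and these zeros cancel in the integrand.\<close>
    define \<gamma> where "\<gamma> t = ?c + (of_real t * \<omega> x)\<^sup>2" for t :: real
    define s where "s t = of_real t * \<omega> x * e (\<gamma> t)" for t :: real
    have \<gamma>S: "\<gamma> t \<in> S" if "t \<in> {0..1}" for t
      using star[of x "t\<^sup>2"] that x \<omega>2[OF x] by (simp add: \<gamma>_def power_mult_distrib power_le_one)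
    have d\<gamma>: "(\<gamma> has_vector_derivative 2 * of_real t * (\<omega> x)\<^sup>2) (at t)" for t
      unfolding \<gamma>_def
      by (rule has_vector_derivative_real_field[of "\<lambda>y. ?c + (y * \<omega> x)\<^sup>2"])
        (auto intro!: derivative_eq_intros simp: power2_eq_square)
    have C1: "\<gamma> C1_differentiable_on {0..1}"
      unfolding C1_differentiable_on_def
      by (intro exI[of _ "\<lambda>t. 2 * of_real t * (\<omega> x)\<^sup>2"]) (use d\<gamma> in \<open>auto intro!: continuous_intros\<close>)
    have cont\<gamma>: "continuous_on {0..1} \<gamma>"
      unfolding \<gamma>_def by (intro continuous_intros)
    have sq: "(s t)\<^sup>2 = D (\<gamma> t)" if "t \<in> {0..1}" for t
      using e(2)[OF \<gamma>S[OF that]] by (simp add: s_def \<gamma>_def power_mult_distrib)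
    have "((\<lambda>t. 2 * U (\<gamma> t) / e (\<gamma> t) * \<omega> x) has_integral (\<Psi> (of_real 1 * \<omega> x) - \<Psi> (of_real 0 * \<omega> x))) {0..1}"
    proof (rule fundamental_theorem_of_calculus)
      fix t :: real assume t: "t \<in> {0..1}"
      have 1: "((\<lambda>t. of_real t * \<omega> x) has_vector_derivative \<omega> x) (at t within {0..1})"
        by (auto intro!: derivative_eq_intros)
      have "(\<Psi> has_field_derivative 2 * U (\<gamma> t) / e (\<gamma> t)) (at (of_real t * \<omega> x) within (\<lambda>t. of_real t * \<omega> x) ` {0..1})"
        using \<Psi>(1)[of "of_real t * \<omega> x"] \<gamma>S[OF t] by (auto simp: \<gamma>_def intro: DERIV_subset)
      from field_vector_diff_chain_within[OF 1 this]
      show "((\<lambda>t. \<Psi> (of_real t * \<omega> x)) has_vector_derivative 2 * U (\<gamma> t) / e (\<gamma> t) * \<omega> x) (at t within {0..1})"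
        by (simp add: o_def mult.commute)
    qed simp
    then have I: "((\<lambda>t. 2 * U (\<gamma> t) / e (\<gamma> t) * \<omega> x) has_integral \<Psi> (\<sigma> x / e x)) {0..1}"
      using \<Psi>(2) by (simp add: \<omega>_def)
    show "abel_integral k z U x (\<sigma> x) (\<Psi> (\<sigma> x / e x))"
      unfolding abel_integral_def
    proof (rule exI[of _ \<gamma>], rule exI[of _ s], intro conjI ballI)
      show "valid_path \<gamma>" unfolding valid_path_def by (rule C1_differentiable_imp_piecewise[OF C1])
      show "pathstart \<gamma> = z 1" "pathfinish \<gamma> = x" using cx by (auto simp: pathstart_def pathfinish_def \<gamma>_def)
      show "continuous_on {0..1} s"
        unfolding s_def
        by (intro continuous_intros continuous_on_compose2[OF holomorphic_on_imp_continuous_on[OF e(1)] cont\<gamma>])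
          (use \<gamma>S in auto)
      show "s 1 = \<sigma> x" using cx e(3)[of x] x by (simp add: s_def \<gamma>_def) (simp add: \<omega>_def)
      show "\<gamma> t \<notin> K" if "t \<in> {0<..<1}" for t
        using e(2,3)[OF \<gamma>S[of t]] that \<omega>0 by (auto simp: D_eq_0_iff[symmetric] \<gamma>_def)
      show "((\<lambda>t. U (\<gamma> t) / s t * vector_derivative \<gamma> (at t within {0..1})) has_integral \<Psi> (\<sigma> x / e x)) {0..1}"
      \<comment> \<open>At \<open>t = 0\<close> the root is 0 and the quotient takes the default
        value 0, so the integrands may differ at that single point.\<close>
      proof (rule has_integral_spike_finite[OF _ _ I, of "{0}"])
        fix t :: real assume t: "t \<in> {0..1} - {0}"
        have "vector_derivative \<gamma> (at t within {0..1}) = 2 * of_real t * (\<omega> x)\<^sup>2"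
          using vector_derivative_at_within_ivl[OF d\<gamma>, of 0 t 1] t by simp
        then show "U (\<gamma> t) / s t * vector_derivative \<gamma> (at t within {0..1}) = 2 * U (\<gamma> t) / e (\<gamma> t) * \<omega> x"
          using t \<omega>0 e(3)[OF \<gamma>S[of t]] by (simp add: s_def field_simps power2_eq_square)
      qed simp
    qed (use sq in auto)
  qed
  with S that show ?thesis by blast
qed

text \<open>On the dense set \<open>G\<close> is the real part of an explicit primitive, which
  determines its gradient. Harmonicity makes the partial derivatives of \<open>G\<close> continuous,
  so the formula extends across the cuts.\<close>

lemma section_deriv_G:
  assumes G: "Z2_harmonic k z G" and U: "U holomorphic_on UNIV"
    and GU: "\<And>x w A. x \<notin> K \<Longrightarrow> abel_integral k z U x w A \<Longrightarrow> G x w = Re A"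
  shows "section_deriv G U"
  unfolding section_deriv_def
proof (intro allI impI)
  fix V \<sigma> x assume t: "local_triv k z V \<sigma>" and x: "x \<in> V"
  note T = local_trivD[OF t]
  obtain S F where S: "open S" "closure S = UNIV"
    and F: "\<And>x. x \<in> V \<inter> S \<Longrightarrow> abel_integral k z U x (\<sigma> x) (F x)"
      "\<And>x. x \<in> V \<inter> S \<Longrightarrow> (F has_field_derivative U x / \<sigma> x) (at x)"
    using abel_integral_on_dense[OF U] t by metis
  have "harmonic_on (\<lambda>x. G x (\<sigma> x)) V" using G t unfolding Z2_harmonic_def by blast
  then obtain ux uy uxx uxy uyx uyy where
    u: "\<forall>x\<in>V. ((\<lambda>x. G x (\<sigma> x)) has_derivative (\<lambda>h. ux x * Re h + uy x * Im h)) (at x) \<and>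
      (ux has_derivative (\<lambda>h. uxx x * Re h + uxy x * Im h)) (at x) \<and>
      (uy has_derivative (\<lambda>h. uyx x * Re h + uyy x * Im h)) (at x) \<and> uxx x + uyy x = 0"
    unfolding harmonic_on_def by (elim exE conjE) (rule that)
  have cont: "continuous_on V ux" "continuous_on V uy"
    using u by (auto intro!: continuous_at_imp_continuous_on intro: has_derivative_continuous)
  have contU: "continuous_on V U"
    using U by (meson continuous_on_subset holomorphic_on_imp_continuous_on top_greatest)
  have eq: "(\<lambda>h. ux y * Re h + uy y * Im h) = (\<lambda>h. Re (U y / \<sigma> y * h))" if y: "y \<in> V \<inter> S" for y
  proof -
    have "((\<lambda>y. Re (F y)) has_derivative (\<lambda>h. Re (U y / \<sigma> y * h))) (at y)"
      using F(2)[OF y] unfolding has_field_derivative_def by (rule has_derivative_Re)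
    then have "((\<lambda>y. G y (\<sigma> y)) has_derivative (\<lambda>h. Re (U y / \<sigma> y * h))) (at y)"
      by (rule has_derivative_transform_within_open[of _ _ _ _ "V \<inter> S"])
        (use S(1) T(1,2) y GU[OF T(2) F(1)] in auto)
    then show ?thesis using u y has_derivative_unique by blast
  qed
  have uxy: "ux y = Re (U y / \<sigma> y)" "uy y = - Im (U y / \<sigma> y)" if "y \<in> V \<inter> S" for y
    using eq[OF that, THEN fun_cong, of 1] eq[OF that, THEN fun_cong, of \<i>]
    by (simp_all del: times_divide_eq_left)
  have contUs: "continuous_on V (\<lambda>x. U x / \<sigma> x)"
    using T(4,6) contU by (intro continuous_intros) auto
  have "ux x - Re (U x / \<sigma> x) = 0"
    by (rule continuous_eq_0_of_dense[OF T(1) _ S(2) _ x])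
      (use uxy cont contUs in \<open>auto intro!: continuous_on_diff continuous_on_Re\<close>)
  moreover have "uy x + Im (U x / \<sigma> x) = 0"
    by (rule continuous_eq_0_of_dense[OF T(1) _ S(2) _ x])
      (use uxy cont contUs in \<open>auto intro!: continuous_on_add continuous_on_Im\<close>)
  ultimately have "ux x = Re (U x / \<sigma> x)" "uy x = - Im (U x / \<sigma> x)" by simp_all
  with u[rule_format, OF x] show "((\<lambda>y. G y (\<sigma> y)) has_derivative (\<lambda>h. Re (U x / \<sigma> x * h))) (at x)"
    by (simp del: times_divide_eq_left)
qed

end

section \<open>The Pell equation\<close>

text \<open>Here \<open>b\<close> has modulus below 1, so \<open>a\<close> lies within distance
  \<open>cmod P\<close> of \<open>2 * P\<close>. The factors p + q sqrt D and p - q sqrt D play the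
  roles of \<open>a\<close> and \<open>b\<close>, in either order.\<close>

lemma one_lt_norm_bounds:
  fixes a b P :: complex
  assumes "a * b = 1" "a + b = 2 * P" "cmod a > 1" "cmod P \<ge> 1"
  shows "cmod P \<le> cmod a" "cmod a \<le> 3 * cmod P"
proof -
  have "cmod a * cmod b = 1" using assms(1) by (metis norm_mult norm_one)
  then have b: "cmod b < 1"
    using assms(3) by (smt (verit, best) mult_less_cancel_left2 norm_ge_zero)
  have "cmod (a + b) = 2 * cmod P" unfolding assms(2) by (simp add: norm_mult)
  moreover have "cmod (a + b) \<le> cmod a + cmod b" "cmod a - cmod b \<le> cmod (a + b)"
    by (rule norm_triangle_ineq, metis norm_diff_ineq)
  ultimately show "cmod P \<le> cmod a" "cmod a \<le> 3 * cmod P"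
    using b assms(4) by linarith+
qed

context branch_points
begin

lemma pell_at: "pell k z p q \<Longrightarrow> (poly p x)\<^sup>2 - D x * (poly q x)\<^sup>2 = 1"
  unfolding pell_def by (metis poly_1 poly_diff poly_mult poly_power)

lemma pell_conj:
  assumes "pell k z p q" "w\<^sup>2 = D x"
  shows "(poly p x + poly q x * w) * (poly p x - poly q x * w) = 1"
  using pell_at[OF assms(1), of x] assms(2) by (simp add: algebra_simps power2_eq_square)

text \<open>For constant \<open>p\<close> the product of \<open>D_poly k z\<close> and
  \<open>q\<^sup>2\<close> would be constant, but its degree is at least
  \<open>2 * k\<close>.\<close>

lemma pell_degree_pos:
  assumes "pell k z p q" "q \<noteq> 0"
  shows "degree p > 0"
proof (rule ccontr)
  assume "\<not> degree p > 0"
  moreover have eq: "D_poly k z * q\<^sup>2 = p\<^sup>2 - 1" using assms(1) by (simp add: pell_def algebra_simps)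
  ultimately have "degree (p\<^sup>2 - 1) = 0"
    by (metis bot_nat_0.not_eq_extremum degree_1 degree_diff_le degree_power_le le_zero_eq mult_zero_left)
  moreover have "D_poly k z \<noteq> 0" using degree_D k_pos by fastforce
  then have "degree (D_poly k z * q\<^sup>2) = 2 * k + degree (q\<^sup>2)"
    using assms(2) by (simp add: degree_mult_eq degree_D)
  ultimately show False using eq k_pos by simp
qed

text \<open>
  Differentiating the Pell equation shows that \<open>q\<close> divides \<open>p * p'\<close>, and \<open>p\<close>, \<open>q\<close> are coprime; eliminating
  \<open>p\<^sup>2\<close> gives the quotient \<open>v = p' / q\<close> explicitly, so that \<open>(p + q sqrt D)' = (v / sqrt D) (p + q sqrt D)\<close>.
\<close>

lemma pell_pderiv:
  assumes pell: "pell k z p q" and q: "q \<noteq> 0"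
  obtains v where "pderiv p = v * q"
    "2 * (v * p) = 2 * (pderiv q * D_poly k z) + q * pderiv (D_poly k z)"
proof -
  let ?d = "D_poly k z"
  \<comment> \<open>Take \<open>2 p' = 2 p' (p^2 - D q^2)\<close>, replace \<open>2 p p'\<close> by
    \<open>q (2 D q' + D' q)\<close>, and divide by \<open>2 q\<close>.\<close>
  define v where "v = smult (1/2) (p * (2 * ?d * pderiv q + pderiv ?d * q) - 2 * ?d * q * pderiv p)"
  have v2: "2 * v = p * (2 * ?d * pderiv q + pderiv ?d * q) - 2 * ?d * q * pderiv p"
    by (simp add: v_def numeral_poly)
  have 1: "p * p - ?d * q * q = 1" using pell by (simp add: pell_def power2_eq_square mult.assoc)
  have "pderiv (p * p - ?d * q * q) = 0" unfolding 1 by simp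
  then have 2: "2 * p * pderiv p = 2 * ?d * q * pderiv q + pderiv ?d * q * q"
    by (simp add: pderiv_diff pderiv_mult algebra_simps)
  have "2 * (v * q) = 2 * v * q" by (simp add: mult.assoc)
  also have "\<dots> = p * (2 * ?d * q * pderiv q + pderiv ?d * q * q) - 2 * ?d * q * q * pderiv p"
    unfolding v2 by (simp add: algebra_simps)
  also have "\<dots> = 2 * pderiv p * (p * p - ?d * q * q)"
    unfolding 2[symmetric] by (simp add: algebra_simps)
  also have "\<dots> = 2 * pderiv p" unfolding 1 by simp
  finally have 3: "v * q = pderiv p" by simp
  have "q * (2 * (v * p)) = 2 * p * (v * q)" by (simp add: algebra_simps)
  also have "\<dots> = q * (2 * (pderiv q * ?d) + q * pderiv ?d)"
    unfolding 3 2 by (simp add: algebra_simps)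
  finally have "2 * (v * p) = 2 * (pderiv q * ?d) + q * pderiv ?d" using q by simp
  with 3 that show ?thesis by metis
qed

lemma pell_branch_derivative:
  assumes v: "pderiv p = v * q" "2 * (v * p) = 2 * (pderiv q * D_poly k z) + q * pderiv (D_poly k z)"
    and t: "local_triv k z V \<sigma>" and x: "x \<in> V"
  shows "((\<lambda>y. poly p y + poly q y * \<sigma> y) has_field_derivative
    poly v x / \<sigma> x * (poly p x + poly q x * \<sigma> x)) (at x)"
proof -
  have s: "\<sigma> x \<noteq> 0" "(\<sigma> x)\<^sup>2 = D x" using local_trivD[OF t] x by auto
  have "poly (2 * (v * p)) x = poly (2 * (pderiv q * D_poly k z) + q * pderiv (D_poly k z)) x"
    using v(2) by simp
  then have "2 * (poly v x * poly p x) = 2 * (poly (pderiv q) x * (\<sigma> x)\<^sup>2) + poly q x * poly (pderiv (D_poly k z)) x"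
    by (simp add: s)
  \<comment> \<open>Divided by \<open>2 * \<sigma> x\<close>, the preceding identity says that
    \<open>v p / \<sigma>\<close> is the derivative of the root part \<open>q \<sigma>\<close>,
    apart from the summand coming from \<open>p\<close>.\<close>
  then have "poly v x / \<sigma> x * (poly p x + poly q x * \<sigma> x) = poly v x * poly q x
      + (poly (pderiv q) x * \<sigma> x + poly (pderiv (D_poly k z)) x / (2 * \<sigma> x) * poly q x)"
    using s(1) by (simp add: field_simps power2_eq_square)
  moreover have "((\<lambda>y. poly p y + poly q y * \<sigma> y) has_field_derivative poly (pderiv p) x
      + (poly (pderiv q) x * \<sigma> x + poly (pderiv (D_poly k z)) x / (2 * \<sigma> x) * poly q x)) (at x)"
    by (intro DERIV_add DERIV_mult poly_DERIV branch_has_field_derivative[OF t x])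
  ultimately show ?thesis by (simp add: v(1))
qed

section \<open>The logarithmic section of a Pell solution\<close>

lemma section_deriv_ln_pell:
  assumes pell: "pell k z p q"
    and v: "pderiv p = v * q" "2 * (v * p) = 2 * (pderiv q * D_poly k z) + q * pderiv (D_poly k z)"
  shows "section_deriv (\<lambda>x w. ln (cmod (poly p x + poly q x * w))) (poly v)"
  unfolding section_deriv_def
proof (intro allI impI)
  fix V \<sigma> x assume t: "local_triv k z V \<sigma>" "x \<in> V"
  let ?a = "\<lambda>y. poly p y + poly q y * \<sigma> y"
  have a0: "?a x \<noteq> 0"
    using pell_conj[OF pell local_trivD(3)[OF t]] by auto
  have "((\<lambda>y. ln (cmod (?a y))) has_derivative (\<lambda>h. Re (poly v x / \<sigma> x * ?a x * h / ?a x))) (at x)"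
    by (rule has_derivative_compose[of ?a _ x UNIV, OF _ has_derivative_ln_cmod[OF a0]])
      (use pell_branch_derivative[OF v t] in \<open>simp only: has_field_derivative_def\<close>)
  moreover have "poly v x / \<sigma> x * ?a x * h / ?a x = poly v x / \<sigma> x * h" for h
    using a0 by simp
  ultimately show "((\<lambda>y. ln (cmod (?a y))) has_derivative (\<lambda>h. Re (poly v x / \<sigma> x * h))) (at x)"
    by simp
qed

lemma is_section_ln_pell:
  assumes "pell k z p q"
  shows "is_section k z (\<lambda>x w. ln (cmod (poly p x + poly q x * w)))"
  unfolding is_section_def
proof (intro allI impI)
  fix x w assume "w\<^sup>2 = D x"
  then have "(poly p x + poly q x * w) * (poly p x - poly q x * w) = 1"
    by (rule pell_conj[OF assms])
  then have "cmod (poly p x - poly q x * w) = inverse (cmod (poly p x + poly q x * w))"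
    by (metis inverse_unique norm_inverse)
  then show "ln (cmod (poly p x + poly q x * - w)) = - ln (cmod (poly p x + poly q x * w))"
    by (cases "poly p x + poly q x * w = 0") (auto simp: ln_inverse)
qed

text \<open>The conjugate factors are inverse to each other with sum \<open>2 * p\<close>. Where the
  modulus of \<open>p\<close> is at least 2 neither has modulus 1, so by connectedness of the
  exterior the same factor is large throughout; \<open>\<epsilon>\<close> records which one. The
  large factor is comparable with \<open>p\<close>, hence with a power of \<open>x\<close>.\<close>

lemma ln_pell_growth:
  assumes pell: "pell k z p q" and q: "q \<noteq> 0" and t: "local_triv k z {x. cmod x > R} s"
  obtains \<epsilon> B r :: real where "\<epsilon> = 1 \<or> \<epsilon> = - 1"
    "\<And>x. cmod x > r \<Longrightarrow>
      \<bar>\<epsilon> * ln (cmod (poly p x + poly q x * s x)) - real (degree p) * ln (cmod x)\<bar> \<le> B"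
proof -
  let ?m = "degree p"
  define lc where "lc = cmod (lead_coeff p)"
  have m: "?m > 0" by (rule pell_degree_pos[OF pell q])
  then have lc: "lc > 0" by (auto simp: lc_def)
  have lim: "((\<lambda>x. cmod (poly p x / x ^ ?m)) \<longlongrightarrow> lc) at_infinity"
    unfolding lc_def by (intro tendsto_norm poly_divide_tendsto_aux)
  have "\<forall>\<^sub>F x in at_infinity. cmod (poly p x / x ^ ?m) > lc / 2"
      "\<forall>\<^sub>F x in at_infinity. cmod (poly p x / x ^ ?m) < 2 * lc"
    using lc by (auto intro!: order_tendstoD[OF lim] simp del: less_divide_eq_numeral1 divide_less_eq_numeral1)
  moreover have "\<forall>\<^sub>F x in at_infinity. cmod (poly p x) \<ge> 2"
    using filterlim_poly_at_infinity[of p] m by (simp add: filterlim_at_infinity[OF order.refl])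
  ultimately have "\<forall>\<^sub>F x in at_infinity. cmod (poly p x / x ^ ?m) > lc / 2 \<and>
      cmod (poly p x / x ^ ?m) < 2 * lc \<and> cmod (poly p x) \<ge> 2"
    by (intro eventually_conj)
  then obtain r0 where r0: "\<And>x. cmod x \<ge> r0 \<Longrightarrow> cmod (poly p x / x ^ ?m) > lc / 2 \<and>
      cmod (poly p x / x ^ ?m) < 2 * lc \<and> cmod (poly p x) \<ge> 2"
    unfolding eventually_at_infinity by blast
  define r where "r = Max {r0, R, 1}"
  have r: "r \<ge> r0" "r \<ge> R" "r \<ge> 1" by (auto simp: r_def)
  let ?E = "- cball 0 r :: complex set"
  define a where "a x = poly p x + poly q x * s x" for x
  define b where "b x = poly p x - poly q x * s x" for x
  have ab: "a x * b x = 1" "a x + b x = 2 * poly p x" if "x \<in> ?E" for x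
    using pell_conj[OF pell] local_trivD(3)[OF t, of x] that r by (auto simp: a_def b_def)
  have "continuous_on ?E s"
    by (rule continuous_on_subset[OF local_trivD(6)[OF t]]) (use r in auto)
  then have conta: "continuous_on ?E (\<lambda>x. cmod (a x))"
    unfolding a_def by (intro continuous_intros)
  have "connected ?E" by (intro connected_complement_bounded_convex) auto
  then have conn: "connected ((\<lambda>x. cmod (a x)) ` ?E)"
    by (rule connected_continuous_image[OF conta])
  have ne1: "cmod (a x) \<noteq> 1" if "x \<in> ?E" for x
  proof
    assume 1: "cmod (a x) = 1"
    then have "cmod (b x) = 1" using ab(1)[OF that] by (metis mult_1 norm_mult norm_one)
    then have "cmod (a x + b x) \<le> 2" using 1 norm_triangle_ineq[of "a x" "b x"] by simp
    moreover have "cmod (a x + b x) = 2 * cmod (poly p x)"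
      unfolding ab(2)[OF that] by (simp add: norm_mult)
    ultimately show False using r0[of x] that r by auto
  qed
  \<comment> \<open>The first two terms bracket the modulus of \<open>p\<close> relative to that of
    \<open>x ^ ?m\<close>; \<open>ln 3\<close> is the cost of passing from \<open>p\<close> to the
    large factor.\<close>
  define B where "B = \<bar>ln (lc / 2)\<bar> + \<bar>ln (2 * lc)\<bar> + ln 3"
  have bound: "\<bar>ln (cmod c) - ?m * ln (cmod x)\<bar> \<le> B"
    if x: "x \<in> ?E" and c: "c * d = 1" "c + d = 2 * poly p x" "cmod c > 1" for c d x
  proof -
    have x0: "cmod x > 0" "x \<noteq> 0" using x r by auto
    have px: "cmod (poly p x) \<ge> 2" "lc / 2 < cmod (poly p x) / cmod x ^ ?m" "cmod (poly p x) / cmod x ^ ?m < 2 * lc"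
      using r0[of x] x r by (auto simp: norm_divide norm_power)
    have p0: "poly p x \<noteq> 0" using px(1) by auto
    have l: "ln (cmod (poly p x) / cmod x ^ ?m) = ln (cmod (poly p x)) - ?m * ln (cmod x)"
      using p0 x0 by (simp add: ln_div ln_realpow)
    have "ln (lc / 2) \<le> ln (cmod (poly p x)) - ?m * ln (cmod x)"
      "ln (cmod (poly p x)) - ?m * ln (cmod x) \<le> ln (2 * lc)"
      unfolding l[symmetric] using px lc x0 by (auto intro!: ln_mono divide_pos_pos)
    moreover have "ln (cmod (poly p x)) \<le> ln (cmod c)" "ln (cmod c) \<le> ln (3 * cmod (poly p x))"
      using one_lt_norm_bounds[OF c] px(1) by (auto intro!: ln_mono)
    moreover have "ln (3 * cmod (poly p x)) = ln 3 + ln (cmod (poly p x))"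
      using px(1) by (intro ln_mult_pos) auto
    ultimately show ?thesis by (auto simp: B_def abs_le_iff)
  qed
  show ?thesis
  proof (cases "\<exists>x\<in>?E. cmod (a x) > 1")
    case True
    have "cmod (a x) > 1" if "x \<in> ?E" for x
      using True connectedD_interval[OF conn] ne1 that by (smt (verit) image_iff)
    then show ?thesis
      using bound[OF _ ab] by (intro that[of 1 r B]) (auto simp: a_def)
  next
    case False
    have "cmod (b x) > 1" if x: "x \<in> ?E" for x
    proof -
      have "cmod (a x) * cmod (b x) = 1" using ab(1)[OF x] by (metis norm_mult norm_one)
      moreover have "cmod (a x) < 1" using False ne1[OF x] x by force
      moreover have "cmod (a x) * cmod (b x) \<le> cmod (a x) * 1" if "cmod (b x) \<le> 1"
        using that by (rule mult_left_mono) simp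
      ultimately show ?thesis by linarith
    qed
    moreover have "ln (cmod (a x)) = - ln (cmod (b x))" if "x \<in> ?E" for x
    proof -
      have "b x = inverse (a x)" using ab(1)[OF that] by (metis inverse_unique)
      then show ?thesis by (cases "a x = 0") (simp_all add: norm_inverse ln_inverse)
    qed
    moreover have "\<bar>ln (cmod (b x)) - ?m * ln (cmod x)\<bar> \<le> B" if x: "x \<in> ?E" for x
      by (rule bound[OF x, of "b x" "a x"]) (use ab[OF x] calculation x in \<open>simp_all add: mult.commute add.commute\<close>)
    ultimately show ?thesis
      by (intro that[of "-1" r B]) (auto simp: a_def)
  qed
qed


section \<open>Identification of \<open>p' / q\<close> with a multiple of \<open>U\<close>\<close>

lemma pell_pderiv_eq_U:
  assumes t: "local_triv k z {x. cmod x > R} s" and G: "is_G_D k z s G" and U: "is_U_D k z G U"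
    and pell: "pell k z p q" and q: "q \<noteq> 0"
  obtains c :: real and v where "c \<noteq> 0" "\<And>x. poly v x = of_real c * U x" "pderiv p = v * q"
    "2 * (v * p) = 2 * (pderiv q * D_poly k z) + q * pderiv (D_poly k z)"
proof -
  have U_hol: "U holomorphic_on UNIV" using U unfolding is_U_D_def admissible_def by blast
  have Z: "Z2_harmonic k z G" using G unfolding is_G_D_def by blast
  have GU: "section_deriv G U"
    using section_deriv_G[OF Z U_hol] U unfolding is_U_D_def by blast
  obtain v where v: "pderiv p = v * q"
    "2 * (v * p) = 2 * (pderiv q * D_poly k z) + q * pderiv (D_poly k z)"
    by (rule pell_pderiv[OF pell q])
  obtain \<epsilon> r B :: real where \<epsilon>: "\<epsilon> = 1 \<or> \<epsilon> = - 1"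
    and growth: "\<And>x. cmod x > r \<Longrightarrow>
      \<bar>\<epsilon> * ln (cmod (poly p x + poly q x * s x)) - real (degree p) * ln (cmod x)\<bar> \<le> B"
    by (rule ln_pell_growth[OF pell q t]) blast
  define m where "m = real (degree p)"
  define L where "L x w = ln (cmod (poly p x + poly q x * w))" for x w
  define H where "H x w = \<epsilon> * m * G x w - L x w" for x w
  define W where "W x = of_real (\<epsilon> * m) * U x - poly v x" for x
  have m: "m > 0" using pell_degree_pos[OF pell q] by (simp add: m_def)
  have "section_deriv H W"
    unfolding section_deriv_def
  proof (intro allI impI)
    fix V \<sigma> x assume V: "local_triv k z V \<sigma>" "x \<in> V"
    have "((\<lambda>y. H y (\<sigma> y)) has_derivative
        (\<lambda>h. \<epsilon> * m * Re (U x / \<sigma> x * h) - Re (poly v x / \<sigma> x * h))) (at x)"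
      unfolding H_def
      by (intro has_derivative_diff has_derivative_mult_right section_derivD[OF GU V]
          section_derivD[OF section_deriv_ln_pell[OF pell v] V, folded L_def])
    moreover have "\<epsilon> * m * Re (U x / \<sigma> x * h) - Re (poly v x / \<sigma> x * h) = Re (W x / \<sigma> x * h)" for h
    proof -
      have "W x / \<sigma> x * h = (\<epsilon> * m) *\<^sub>R (U x / \<sigma> x * h) - poly v x / \<sigma> x * h"
        by (simp add: W_def scaleR_conv_of_real diff_divide_distrib left_diff_distrib)
      then show ?thesis by (simp only: minus_complex.sel scaleR_complex.sel)
    qed
    ultimately show "((\<lambda>y. H y (\<sigma> y)) has_derivative (\<lambda>h. Re (W x / \<sigma> x * h))) (at x)" by simp
  qed
  moreover have "is_section k z H"
    using is_section_ln_pell[OF pell] Z unfolding is_section_def Z2_harmonic_def H_def L_def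
    by simp
  moreover have "W holomorphic_on UNIV"
    unfolding W_def by (intro holomorphic_intros U_hol)
  moreover obtain r' B' where "\<And>x. cmod x > r' \<Longrightarrow> \<bar>H x (s x)\<bar> \<le> B'"
  proof -
    obtain c where "((\<lambda>x. G x (s x) - ln (cmod x)) \<longlongrightarrow> c) at_infinity"
      using G unfolding is_G_D_def by blast
    then have "\<forall>\<^sub>F x in at_infinity. dist (G x (s x) - ln (cmod x)) c < 1"
      by (rule tendstoD) simp
    then obtain b where b: "\<And>x. cmod x \<ge> b \<Longrightarrow> \<bar>G x (s x) - ln (cmod x)\<bar> \<le> \<bar>c\<bar> + 1"
      unfolding eventually_at_infinity dist_real_def by fastforce
    have "\<bar>H x (s x)\<bar> \<le> m * (\<bar>c\<bar> + 1) + B" if x: "cmod x > max b r" for x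
    proof -
      have "\<bar>m * (G x (s x) - ln (cmod x))\<bar> \<le> m * (\<bar>c\<bar> + 1)"
        using b[of x] x m by (simp add: abs_mult)
      moreover have "\<bar>\<epsilon> * L x (s x) - m * ln (cmod x)\<bar> \<le> B"
        using growth[of x] x by (simp add: L_def m_def)
      \<comment> \<open>Multiplying \<open>H\<close> by the sign \<open>\<epsilon>\<close> makes the
        two terms \<open>m * ln (cmod x)\<close> cancel.\<close>
      moreover have "\<bar>H x (s x)\<bar> = \<bar>m * (G x (s x) - ln (cmod x)) - (\<epsilon> * L x (s x) - m * ln (cmod x))\<bar>"
        using \<epsilon> by (auto simp: H_def algebra_simps)
      ultimately show ?thesis by linarith
    qed
    then show ?thesis by (rule that)
  qed
  ultimately have "W x = 0" for x
    using bounded_section_deriv_eq_0[OF _ _ _ t] by blast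
  then show ?thesis
    using that[of "\<epsilon> * m" v] v m \<epsilon> by (auto simp: W_def)
qed

section \<open>The logarithmic formula\<close>

text \<open>Along a path both p + q sqrt D and the exponential of \<open>c\<close> times the running
  integral solve the same linear differential equation, so their quotient \<open>\<Phi>\<close> is
  constant. At the start the root is 0, which leaves \<open>p (z 1)\<close>.\<close>

lemma exp_abel_integral:
  assumes v: "pderiv p = v * q" "2 * (v * p) = 2 * (pderiv q * D_poly k z) + q * pderiv (D_poly k z)"
    and U: "U holomorphic_on UNIV" and vU: "\<And>x. poly v x = of_real c * U x"
    and A: "abel_integral k z U x w A"
  shows "poly p x + poly q x * w = poly p (z 1) * exp (of_real c * A)"
proof -
  obtain \<gamma> s where \<gamma>: "valid_path \<gamma>" "pathstart \<gamma> = z 1" "pathfinish \<gamma> = x"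
    "\<And>t. t \<in> {0<..<1} \<Longrightarrow> \<gamma> t \<notin> K" and s: "continuous_on {0..1} s"
    "\<And>t. t \<in> {0..1} \<Longrightarrow> (s t)\<^sup>2 = D (\<gamma> t)" "s 1 = w"
    and int: "((\<lambda>t. U (\<gamma> t) / s t * vector_derivative \<gamma> (at t within {0..1})) has_integral A) {0..1}"
    using A unfolding abel_integral_def by blast
  define f where "f t = U (\<gamma> t) / s t * vector_derivative \<gamma> (at t within {0..1})" for t
  have f_int: "f integrable_on {0..1}" "integral {0..1} f = A"
    using int unfolding f_def by (auto simp: has_integral_integrable_integral)
  obtain N where N: "finite N" "\<gamma> C1_differentiable_on {0..1} - N" and cont\<gamma>: "continuous_on {0..1} \<gamma>"
    using \<gamma>(1) unfolding valid_path_def piecewise_C1_differentiable_on_def by blast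
  obtain \<gamma>' where \<gamma>': "\<And>t. t \<in> {0..1} - N \<Longrightarrow> (\<gamma> has_vector_derivative \<gamma>' t) (at t)"
    "continuous_on ({0..1} - N) \<gamma>'"
    using N(2) unfolding C1_differentiable_on_def by blast
  \<comment> \<open>Break points of the path and the endpoints, where \<open>s\<close> may vanish,
    are set aside; continuity of \<open>\<Phi>\<close> bridges this finite set.\<close>
  define N' where "N' = insert 0 (insert 1 N)"
  have fN': "finite N'" using N(1) by (simp add: N'_def)
  have O_eq: "{0..1} - N' = {0<..<1} - N" by (auto simp: N'_def)
  have opO: "open ({0..1} - N')"
    unfolding O_eq using N(1) by (intro open_Diff finite_imp_closed) auto
  have s0: "s t \<noteq> 0" if "t \<in> {0<..<1}" for t
    using s(2)[of t] \<gamma>(4)[OF that] that by (auto simp: D_eq_0_iff[symmetric])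
  have contf: "continuous_on ({0..1} - N') f"
  proof -
    have "continuous_on ({0..1} - N') (\<lambda>t. U (\<gamma> t) / s t * \<gamma>' t)"
    proof (intro continuous_intros)
      show "continuous_on ({0..1} - N') (\<lambda>t. U (\<gamma> t))"
        by (rule continuous_on_compose2[OF holomorphic_on_imp_continuous_on[OF U]])
          (auto intro: continuous_on_subset[OF cont\<gamma>])
      show "continuous_on ({0..1} - N') s" by (rule continuous_on_subset[OF s(1)]) auto
      show "continuous_on ({0..1} - N') \<gamma>'"
        by (rule continuous_on_subset[OF \<gamma>'(2)]) (auto simp: N'_def)
    qed (use s0 O_eq in auto)
    moreover have "U (\<gamma> t) / s t * \<gamma>' t = f t" if "t \<in> {0..1} - N'" for t
      using vector_derivative_at_within_ivl[OF \<gamma>'(1)[of t], of 0 1] that by (auto simp: f_def N'_def)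
    ultimately show ?thesis by (rule continuous_on_eq)
  qed
  define g where "g t = poly p (\<gamma> t) + poly q (\<gamma> t) * s t" for t
  define \<Phi> where "\<Phi> t = g t * exp (- of_real c * integral {0..t} f)" for t
  have d0: "(\<Phi> has_derivative (\<lambda>h. 0)) (at t within {0..1})" if t: "t \<in> {0..1} - N'" for t
  proof -
    have t01: "t \<in> {0<..<1}" "t \<in> {0..1} - N" using t by (auto simp: N'_def)
    have "continuous (at t within {0..1} - N') f"
      using contf t by (simp add: continuous_on_eq_continuous_within)
    from integral_has_vector_derivative_continuous_at[OF f_int(1) t fN' this]
    have dI: "((\<lambda>u. integral {0..u} f) has_vector_derivative f t) (at t)"
      by (simp only: at_within_open[OF t opO])
    have ev: "\<forall>\<^sub>F y in nhds t. y \<in> {0<..<1}" by (rule eventually_nhds_in_open) (use t01 in auto)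
    have 1: "isCont \<gamma> t" using \<gamma>'(1)[OF t01(2)] by (rule has_vector_derivative_continuous)
    have 2: "isCont s t"
      using continuous_on_interior[OF s(1)] t01(1) by simp
    have 3: "\<forall>\<^sub>F y in nhds t. (s y)\<^sup>2 = D (\<gamma> y)"
      using ev by eventually_elim (simp add: s(2))
    \<comment> \<open>The root \<open>s\<close> is only known to be continuous; locally it is a
      holomorphic branch along \<open>\<gamma>\<close>, hence differentiable at
      \<open>t\<close>.\<close>
    obtain V \<sigma> where V: "local_triv k z V \<sigma>" "\<gamma> t \<in> V" "\<sigma> (\<gamma> t) = s t"
      "\<forall>\<^sub>F y in nhds t. s y = \<sigma> (\<gamma> y)"
      using lift_eq_branch[OF 1 2 3 \<gamma>(4)[OF t01(1)]] .
    have "((\<lambda>y. poly p (\<gamma> y) + poly q (\<gamma> y) * \<sigma> (\<gamma> y)) has_vector_derivative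
        \<gamma>' t * (poly v (\<gamma> t) / s t * g t)) (at t)"
      using field_vector_diff_chain_at[OF \<gamma>'(1)[OF t01(2)] pell_branch_derivative[OF v V(1,2)]] V(3)
      by (simp add: o_def g_def)
    moreover have "\<gamma>' t * (poly v (\<gamma> t) / s t * g t) = of_real c * f t * g t"
      using vector_derivative_at_within_ivl[OF \<gamma>'(1)[OF t01(2)], of 0 1] t01(1)
      by (simp add: f_def vU)
    ultimately have "((\<lambda>y. poly p (\<gamma> y) + poly q (\<gamma> y) * \<sigma> (\<gamma> y)) has_derivative
        (\<lambda>h. h *\<^sub>R (of_real c * f t * g t))) (at t)"
      by (simp only: has_vector_derivative_def)
    moreover have "\<forall>\<^sub>F y in at t. poly p (\<gamma> y) + poly q (\<gamma> y) * \<sigma> (\<gamma> y) = g y"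
      using V(4) unfolding eventually_at_filter by eventually_elim (simp add: g_def)
    ultimately have dg: "(g has_vector_derivative of_real c * f t * g t) (at t)"
      unfolding has_vector_derivative_def
      by (rule has_derivative_transform_eventually) (simp_all add: g_def V(3))
    have "((\<lambda>u. - of_real c * integral {0..u} f) has_vector_derivative - of_real c * f t) (at t)"
      by (rule has_vector_derivative_mult_right[OF dI])
    from field_vector_diff_chain_at[OF this DERIV_exp]
    have "((\<lambda>u. exp (- of_real c * integral {0..u} f)) has_vector_derivative
        - of_real c * f t * exp (- of_real c * integral {0..t} f)) (at t)"
      by (simp add: o_def)
    from has_vector_derivative_mult[OF dg this]
    have "(\<Phi> has_vector_derivative 0) (at t)"
      by (simp add: \<Phi>_def[abs_def] algebra_simps)
    then have "(\<Phi> has_derivative (\<lambda>h. 0)) (at t)"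
      by (simp add: has_vector_derivative_def)
    then show ?thesis by (rule has_derivative_at_withinI)
  qed
  have "continuous_on {0..1} \<Phi>"
    unfolding \<Phi>_def g_def
    by (intro continuous_intros cont\<gamma> s(1) indefinite_integral_continuous_1[OF f_int(1)])
  from has_derivative_zero_unique_strong_interval[OF fN' this refl d0, of 1]
  have "\<Phi> 1 = \<Phi> 0" by simp
  moreover have "\<gamma> 0 = z 1" "\<gamma> 1 = x" using \<gamma>(2,3) by (auto simp: pathstart_def pathfinish_def)
  moreover have "s 0 = 0"
    using s(2)[of 0] \<gamma>(2) D_eq_0_iff[THEN iffD2, OF z1_in_K] by (simp add: pathstart_def)
  ultimately have "(poly p x + poly q x * w) * exp (- (of_real c * A)) = poly p (z 1)"
    using f_int(2) s(3) by (simp add: \<Phi>_def g_def)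
  then show ?thesis by (auto simp: exp_minus field_simps)
qed

text \<open>The Pell equation at \<open>z 1\<close> leaves \<open>p (z 1)\<close> equal to 1 or -1;
  the integer \<open>n\<close>, 0 or 1 accordingly, absorbs this sign.\<close>

lemma pell_imp_abel_log_formula:
  assumes v: "pderiv p = v * q" "2 * (v * p) = 2 * (pderiv q * D_poly k z) + q * pderiv (D_poly k z)"
    and U: "U holomorphic_on UNIV" and vU: "\<And>x. poly v x = of_real c * U x"
    and c: "c \<noteq> 0" and pell: "pell k z p q"
  shows "abel_log_formula k z U p q (1 / c)"
proof -
  have "(poly p (z 1))\<^sup>2 = 1"
    using pell_at[OF pell, of "z 1"] D_eq_0_iff[THEN iffD2, OF z1_in_K] by simp
  then have "poly p (z 1) = 1 \<or> poly p (z 1) = - 1" by (simp add: power2_eq_1_iff)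
  then obtain n :: int where n: "exp (- (of_int n * of_real pi * \<i>)) = poly p (z 1)"
  proof
    assume "poly p (z 1) = 1" then show ?thesis using that[of 0] by simp
  next
    assume "poly p (z 1) = - 1" then show ?thesis using that[of 1] by (simp add: exp_minus)
  qed
  show ?thesis
    unfolding abel_log_formula_def
  proof (intro exI[of _ n] allI impI)
    fix x w A assume A: "abel_integral k z U x w A"
    define l where "l = of_real c * A - of_int n * of_real pi * \<i>"
    have "exp l = exp (- (of_int n * of_real pi * \<i>)) * exp (of_real c * A)"
      unfolding exp_add[symmetric] l_def by simp
    also have "\<dots> = poly p x + poly q x * w"
      unfolding n exp_abel_integral[OF v U vU A] ..
    finally show "\<exists>l. exp l = poly p x + poly q x * w \<and>
        A = of_real (1 / c) * (l + of_int n * of_real pi * \<i>)"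
      using c by (intro exI[of _ l]) (simp add: l_def)
  qed
qed

text \<open>Adding the formulas for \<open>A\<close> on one sheet and \<open>- A\<close> on the
  other gives \<open>l + l' = - 2 n pi \<i>\<close>, so the conjugate factors have product 1. A far
  point where \<open>G\<close> is nonzero shows both \<open>C \<noteq> 0\<close>, used for the
  division, and \<open>q \<noteq> 0\<close>.\<close>

lemma abel_log_formula_imp_pell:
  assumes t: "local_triv k z {x. cmod x > R} s" and G: "is_G_D k z s G" and U: "is_U_D k z G U"
    and F: "abel_log_formula k z U p q C"
  shows "pell k z p q" "q \<noteq> 0"
proof -
  have U_hol: "U holomorphic_on UNIV" using U unfolding is_U_D_def admissible_def by blast
  have GU: "\<And>x w A. x \<notin> K \<Longrightarrow> abel_integral k z U x w A \<Longrightarrow> G x w = Re A"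
    using U unfolding is_U_D_def by blast
  obtain n :: int where n: "\<And>x w A. x \<notin> K \<Longrightarrow> abel_integral k z U x w A \<Longrightarrow>
      \<exists>l. exp l = poly p x + poly q x * w \<and> A = of_real C * (l + of_int n * of_real pi * \<i>)"
    using F unfolding abel_log_formula_def by blast
  obtain S E where S: "open S" "closure S = UNIV"
    and E: "\<And>x. x \<in> {x. cmod x > R} \<inter> S \<Longrightarrow> abel_integral k z U x (s x) (E x)"
    using abel_integral_on_dense[OF U_hol] t by metis
  note T = local_trivD[OF t]
  have far: "\<exists>x\<in>S. cmod x > b" for b
  proof -
    have "closure S \<inter> - cball 0 b \<noteq> {}"
      using S(2) bounded_cball[of "0::complex" b] not_bounded_UNIV by (metis Compl_UNIV_eq
          Int_UNIV_left double_complement)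
    then have "S \<inter> - cball 0 b \<noteq> {}"
      using open_Int_closure_eq_empty[of "- cball 0 b" S] by (auto simp: Int_commute)
    then show ?thesis by (auto simp: not_le)
  qed
  obtain c where "((\<lambda>x. G x (s x) - ln (cmod x)) \<longlongrightarrow> c) at_infinity"
    using G unfolding is_G_D_def by blast
  then have "\<forall>\<^sub>F x in at_infinity. dist (G x (s x) - ln (cmod x)) c < 1"
    by (rule tendstoD) simp
  then obtain b where b: "\<And>x. cmod x \<ge> b \<Longrightarrow> \<bar>G x (s x) - ln (cmod x) - c\<bar> < 1"
    unfolding eventually_at_infinity dist_real_def by blast
  \<comment> \<open>The bound \<open>exp (\<bar>c\<bar> + 1)\<close> makes
    \<open>ln (cmod y) + c - 1\<close> nonnegative, hence \<open>G\<close> positive at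
    \<open>y\<close>; density of \<open>S\<close> lets \<open>y\<close> carry an Abel
    integral.\<close>
  obtain y where y: "y \<in> S" "cmod y > Max {b, R, exp (\<bar>c\<bar> + 1)}"
    using far by blast
  have "ln (cmod y) \<ge> ln (exp (\<bar>c\<bar> + 1))"
    using y(2) by (intro ln_mono) auto
  then have Gy: "G y (s y) \<noteq> 0" using b[of y] y(2) by auto
  have yA: "abel_integral k z U y (s y) (E y)" using E y by simp
  have yK: "y \<notin> K" using T(2)[of y] y(2) by simp
  have C: "C \<noteq> 0" using n[OF yK yA] GU[OF yK yA] Gy by auto
  have *: "poly (p\<^sup>2 - D_poly k z * q\<^sup>2 - 1) x = 0" if x: "x \<in> {x. cmod x > R} \<inter> S" for x
  proof -
    have xK: "x \<notin> K" and sx: "(s x)\<^sup>2 = D x" using T(2,3)[of x] x by auto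
    obtain l where l: "exp l = poly p x + poly q x * s x"
      "E x = of_real C * (l + of_int n * of_real pi * \<i>)"
      using n[OF xK E[OF x]] by blast
    obtain l' where l': "exp l' = poly p x + poly q x * (- s x)"
      "- E x = of_real C * (l' + of_int n * of_real pi * \<i>)"
      using n[OF xK abel_integral_minus[OF E[OF x]]] by blast
    have "of_real C * (l + l' + 2 * of_int n * of_real pi * \<i>)
        = of_real C * (l + of_int n * of_real pi * \<i>) + of_real C * (l' + of_int n * of_real pi * \<i>)"
      by (simp add: algebra_simps)
    also have "\<dots> = 0" unfolding l(2)[symmetric] l'(2)[symmetric] by simp
    finally have "of_real C * (l + l' + 2 * of_int n * of_real pi * \<i>) = 0" .
    then have "l + l' = 2 * of_int (- n) * of_real pi * \<i>"
      using C by (simp add: add_eq_0_iff)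
    then have "exp (l + l') = exp (2 * of_int (- n) * of_real pi * \<i>)" by (simp only:)
    also have "\<dots> = 1" using exp_integer_2pi[of "of_int (- n)"] by simp
    finally have "exp (l + l') = 1" .
    then have "(poly p x + poly q x * s x) * (poly p x - poly q x * s x) = 1"
      using l(1) l'(1) by (simp add: exp_add)
    then show ?thesis by (simp add: sx[symmetric] algebra_simps power2_eq_square)
  qed
  have "p\<^sup>2 - D_poly k z * q\<^sup>2 - 1 = 0"
  proof (rule ccontr)
    assume "p\<^sup>2 - D_poly k z * q\<^sup>2 - 1 \<noteq> 0"
    then have "finite ({x. cmod x > R} \<inter> S)"
      using * finite_subset[OF _ poly_roots_finite] by blast
    moreover have "y \<in> {x. cmod x > R} \<inter> S" using y by simp
    moreover have "open ({x. cmod x > R} \<inter> S)" using T(1) S(1) by blast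
    ultimately show False by (metis empty_iff finite_imp_not_open)
  qed
  then show pell: "pell k z p q" by (simp add: pell_def)
  show "q \<noteq> 0"
  proof
    assume "q = 0"
    then have "(poly p y)\<^sup>2 = 1" using pell_at[OF pell, of y] by simp
    then have p1: "cmod (poly p y) = 1" by (auto simp: power2_eq_1_iff)
    obtain l where l: "exp l = poly p y" "E y = of_real C * (l + of_int n * of_real pi * \<i>)"
      using n[OF yK yA] \<open>q = 0\<close> by auto
    have "Re l = 0" using p1 l(1) by (metis exp_eq_one_iff norm_exp_eq_Re)
    then have "Re (E y) = 0" by (simp add: l(2))
    with Gy GU[OF yK yA] show False by simp
  qed
qed

end

text \<open>In the second part \<open>q \<noteq> 0\<close> sets aside the constant solutions
  \<open>p = 1\<close> and \<open>p = - 1\<close>, whose logarithms have real part 0 while the Abel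
  integral takes values with nonzero real part.\<close>

theorem theorem8:
  fixes k :: nat and z :: "nat \<Rightarrow> complex"
    and R :: real and s :: "complex \<Rightarrow> complex"
    and G :: "complex \<Rightarrow> complex \<Rightarrow> real" and U :: "complex \<Rightarrow> complex"
  assumes "k \<ge> 1"
    and "inj_on z {1..2 * k}"
    and "local_triv k z {x. cmod x > R} s"
    and "is_G_D k z s G"
    and "is_U_D k z G U"
  shows "(\<forall>p q :: complex poly. pell k z p q \<longrightarrow>
            (\<exists>c :: real. c \<noteq> 0 \<and>
               (\<forall>x. poly q x \<noteq> 0 \<longrightarrow> poly (pderiv p) x / poly q x = of_real c * U x))) \<and>
         (\<forall>p q :: complex poly. pell k z p q \<and> q \<noteq> 0 \<longleftrightarrow>
            (\<exists>C :: real. abel_log_formula k z U p q C))"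
proof -
  interpret branch_points k z using assms(1,2) by unfold_locales
  have U: "U holomorphic_on UNIV" using assms(5) unfolding is_U_D_def admissible_def by blast
  show ?thesis
  proof (intro conjI allI impI)
    fix p q :: "complex poly" assume pell: "pell k z p q"
    show "\<exists>c :: real. c \<noteq> 0 \<and>
        (\<forall>x. poly q x \<noteq> 0 \<longrightarrow> poly (pderiv p) x / poly q x = of_real c * U x)"
    proof (cases "q = 0")
      case True then show ?thesis by (intro exI[of _ 1]) simp
    next
      case False
      obtain c v where "c \<noteq> 0" "\<And>x. poly v x = of_real c * U x" "pderiv p = v * q"
        by (rule pell_pderiv_eq_U[OF assms(3-5) pell False]) blast
      then show ?thesis by (intro exI[of _ c]) simp
    qed
  next
    fix p q :: "complex poly"
    show "pell k z p q \<and> q \<noteq> 0 \<longleftrightarrow> (\<exists>C :: real. abel_log_formula k z U p q C)"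
    proof
      assume pq: "pell k z p q \<and> q \<noteq> 0"
      obtain c v where c: "c \<noteq> 0" and vU: "\<And>x. poly v x = of_real c * U x" and v: "pderiv p = v * q"
        "2 * (v * p) = 2 * (pderiv q * D_poly k z) + q * pderiv (D_poly k z)"
        by (rule pell_pderiv_eq_U[OF assms(3-5) conjunct1[OF pq] conjunct2[OF pq]]) blast
      show "\<exists>C :: real. abel_log_formula k z U p q C"
        using pell_imp_abel_log_formula[OF v U vU c] pq by blast
    qed (use abel_log_formula_imp_pell[OF assms(3-5)] in blast)
  qed
qed

end
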